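(* There is no finite tile set $U$ with the following property: for every 2HAM tile assembly system $\mathcal{T}=(T,S,\tau)$ there exist an initial state $S_{\mathcal{T}}$ consisting of supertiles over $U$ and a temperature $\tau'$ such that the 2HAM tile assembly system $\mathcal{U}=(U,S_{\mathcal{T}},\tau')$ simulates $\mathcal{T}$ (at some scale factor $m$, via some $m$-block representation function). In other words, the 2HAM is not intrinsically universal.
   Context: Two-handed Tile Assembly Model (2HAM). A tile type is a non-rotatable unit square each of whose four sides carries a glue, consisting of a label (a finite string) and a strength (a nonnegative integer). For a finite set $T$ of tile types, an assembly is a partial function $\alpha:\mathbb{Z}^2 \dashrightarrow T$. Two tiles at adjacent positions interact if the glues on their abutting sides have equal labels and positive strength; the binding graph of $\alpha$ has the occupied positions as vertices and an edge, weighted by the glue strength, between each interacting pair. For a positive integer $\tau$ (the temperature), $\alpha$ is $\tau$-stable if every cut of its binding graph has total weight at least $\tau$. A supertile $\tilde{\alpha}$ is the equivalence class of an assembly under translation; it is $\tau$-stable if its assemblies are. For supertiles $\tilde\alpha,\tilde\beta$, the combination set $C^\tau_{\tilde\alpha,\tilde\beta}$ is the set of supertiles $\tilde\gamma$ for which there exist $\alpha\in\tilde\alpha$, $\beta\in\tilde\beta$ with disjoint domains such that $\alpha\cup\beta$ is $\tau$-stable and lies in $\tilde\gamma$. A 2HAM tile assembly system (TAS) is a triple $(T,S,\tau)$ where the initial state $S$ is a multiset of supertiles over $T$ (unless stated otherwise each present in infinite count); $(T,\tau)$ denotes the default initial state consisting of infinitely many copies of each single tile of $T$. The producible supertiles $\mathcal{A}[\mathcal{T}]$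 are those obtainable, starting from the supertiles in $S$, by repeatedly replacing two available supertiles $\tilde\alpha,\tilde\beta$ by some $\tilde\gamma \in C^\tau_{\tilde\alpha,\tilde\beta}$ (including results of infinite such sequences). Write $\tilde\alpha \to^1_{\mathcal{T}} \tilde\beta$ if $\tilde\beta$ arises from $\tilde\alpha$ by one such attachment step (with some producible supertile), $\tilde\alpha \to^{\leq 1}_{\mathcal{T}} \tilde\beta$ if $\tilde\alpha=\tilde\beta$ or $\tilde\alpha \to^1_{\mathcal{T}}\tilde\beta$, and $\tilde\alpha\to_{\mathcal{T}}\tilde\beta$ if $\tilde\beta$ results from $\tilde\alpha$ by a sequence of such steps (possibly none). Simulation. Let $U,T$ be tile sets and $m\geq 1$. An $m$-block over $U$ is a partial function $\mathbb{Z}_m\times\mathbb{Z}_m\dashrightarrow U$, $\mathbb{Z}_m=\{0,\dots,m-1\}$. For an assembly $\alpha$ over $U$, $\alpha^m_{x,y}(i,j)=\alpha(mx+i,my+j)$. An $m$-block representation function is a partial function $R$ from $m$-blocks over $U$ to $T$; it induces $R^*$ on assemblies by $R^*(\alpha)(x,y)=R(\alpha^m_{x,y})$. $\alpha$ maps cleanly to $\beta=R^*(\alpha)$ if either $\alpha$ has at most one nonempty $m$-block, or for every nonempty block $\alpha^m_{x,y}$ some $(x+u,y+v)$ with $(u,v)\in\{(0,0),(\pm1,0),(0,\pm1)\}$ lies in the domain of $\beta$. For a supertile $\tilde\alpha$ over $U$, $\tilde R(\tilde\alpha)=\{R^*(\alpha):\alpha\in\tilde\alpha\}$; $\tilde\alpha$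 maps cleanly if $\tilde R(\tilde\alpha)$ is a supertile over $T$ and every $\alpha\in\tilde\alpha$ maps cleanly to $R^*(\alpha)$. For TASs $\mathcal{T}=(T,S,\tau)$, $\mathcal{U}=(U,S_{\mathcal{T}},\tau')$: (i) equivalent productions: $\{\tilde R(\tilde\alpha):\tilde\alpha\in\mathcal{A}[\mathcal{U}]\}=\mathcal{A}[\mathcal{T}]$ and every $\tilde\alpha\in\mathcal{A}[\mathcal{U}]$ maps cleanly to $\tilde R(\tilde\alpha)$; (ii) $\mathcal{T}$ follows $\mathcal{U}$: for all $\tilde\alpha,\tilde\beta\in\mathcal{A}[\mathcal{U}]$ with $\tilde\alpha\to^1_{\mathcal{U}}\tilde\beta$, $\tilde R(\tilde\alpha)\to^{\leq1}_{\mathcal{T}}\tilde R(\tilde\beta)$; (iii) $\mathcal{U}$ weakly models $\mathcal{T}$: for all $\tilde\alpha,\tilde\beta\in\mathcal{A}[\mathcal{T}]$ with $\tilde\alpha\to^1_{\mathcal{T}}\tilde\beta$ and all $\tilde\alpha'\in\mathcal{A}[\mathcal{U}]$ with $\tilde R(\tilde\alpha')=\tilde\alpha$, there is $\tilde\alpha''\in\mathcal{A}[\mathcal{U}]$ with $\tilde R(\tilde\alpha'')=\tilde\alpha$, $\tilde\alpha'\to_{\mathcal{U}}\tilde\alpha''$, and $\tilde\alpha''\to^1_{\mathcal{U}}\tilde\beta'$ for some $\tilde\beta'\in\mathcal{A}[\mathcal{U}]$ with $\tilde R(\tilde\beta')=\tilde\beta$. $\mathcal{U}$ simulates $\mathcal{T}$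 at scale $m$ (via $R$) if (i), (ii), (iii) hold. *)

theory Defs
  imports Main
begin

text \<open>A glue is a label (a finite string) together with a strength.
  A tile type carries a glue on each of its four sides (north, east, south, west).\<close>
type_synonym glue = "string \<times> nat"

datatype tile = Tile (glueN: glue) (glueE: glue) (glueS: glue) (glueW: glue)

type_synonym pos = "int \<times> int"
type_synonym assembly = "pos \<Rightarrow> tile option"
type_synonym supertile = "assembly set"

text \<open>Strength of the bond between position p and its east or north neighbour q
  (each edge of the binding graph is counted once, oriented east/north).
  Abutting glues interact if they are equal and have positive strength.\<close>
definition bond :: "assembly \<Rightarrow> pos \<Rightarrow> pos \<Rightarrow> nat" where
  "bond \<alpha> p q = (case (\<alpha> p, \<alpha> q) of
      (Some t, Some u) \<Rightarrow>
        if q = (fst p + 1, snd p) \<and> glueE t = glueW u \<and> snd (glueE t) > 0 then snd (glueE t)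
        else if q = (fst p, snd p + 1) \<and> glueN t = glueS u \<and> snd (glueN t) > 0 then snd (glueN t)
        else 0
    | _ \<Rightarrow> 0)"

text \<open>tau-stability: every cut of the binding graph has total weight at least tau.
  (Weights are natural numbers, so the possibly infinite total weight of a cut is
  at least tau iff some finite set of crossing edges has weight at least tau.)\<close>
definition stable :: "nat \<Rightarrow> assembly \<Rightarrow> bool" where
  "stable \<tau> \<alpha> \<longleftrightarrow>
     (\<forall>C. C \<subseteq> dom \<alpha> \<and> C \<noteq> {} \<and> C \<noteq> dom \<alpha> \<longrightarrow>
        (\<exists>F. finite F \<and> F \<subseteq> {(p, q). (p \<in> C \<and> q \<notin> C) \<or> (p \<notin> C \<and> q \<in> C)} \<and>
             \<tau> \<le> (\<Sum>(p, q)\<in>F. bond \<alpha> p q)))"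

definition translate :: "assembly \<Rightarrow> pos \<Rightarrow> assembly" where
  "translate \<alpha> v = (\<lambda>p. \<alpha> (fst p - fst v, snd p - snd v))"

definition supertile_of :: "assembly \<Rightarrow> supertile" where
  "supertile_of \<alpha> = {translate \<alpha> v | v. True}"

definition is_supertile :: "supertile \<Rightarrow> bool" where
  "is_supertile A \<longleftrightarrow> (\<exists>\<alpha>. A = supertile_of \<alpha>)"

definition assembly_over :: "tile set \<Rightarrow> assembly \<Rightarrow> bool" where
  "assembly_over T \<alpha> \<longleftrightarrow> ran \<alpha> \<subseteq> T"

definition supertile_over :: "tile set \<Rightarrow> supertile \<Rightarrow> bool" where
  "supertile_over T A \<longleftrightarrow> is_supertile A \<and> (\<forall>\<alpha>\<in>A. assembly_over T \<alpha>)"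

definition comb :: "nat \<Rightarrow> supertile \<Rightarrow> supertile \<Rightarrow> supertile set" where
  "comb \<tau> A B = {supertile_of (\<alpha> ++ \<beta>) | \<alpha> \<beta>.
       \<alpha> \<in> A \<and> \<beta> \<in> B \<and> dom \<alpha> \<inter> dom \<beta> = {} \<and> stable \<tau> (\<alpha> ++ \<beta>)}"

definition chain_limit :: "(nat \<Rightarrow> assembly) \<Rightarrow> assembly" where
  "chain_limit f = (\<lambda>p. if \<exists>n. f n p \<noteq> None then f (LEAST n. f n p \<noteq> None) p else None)"

text \<open>Producible supertiles of the TAS (T,S,tau) (every supertile of S available in
  infinite count), including results of infinite assembly sequences.\<close>
inductive_set producible :: "supertile set \<Rightarrow> nat \<Rightarrow> supertile set"
  for S :: "supertile set" and \<tau> :: nat where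
  init: "A \<in> S \<Longrightarrow> A \<in> producible S \<tau>"
| combine: "A \<in> producible S \<tau> \<Longrightarrow> B \<in> producible S \<tau> \<Longrightarrow> G \<in> comb \<tau> A B
      \<Longrightarrow> G \<in> producible S \<tau>"
| limit: "supertile_of (f 0) \<in> producible S \<tau> \<Longrightarrow>
      (\<And>n. \<exists>\<beta>. supertile_of \<beta> \<in> producible S \<tau> \<and> dom (f n) \<inter> dom \<beta> = {} \<and>
              f (Suc n) = f n ++ \<beta> \<and> stable \<tau> (f (Suc n))) \<Longrightarrow>
      supertile_of (chain_limit f) \<in> producible S \<tau>"

definition step :: "supertile set \<Rightarrow> nat \<Rightarrow> supertile \<Rightarrow> supertile \<Rightarrow> bool" where
  "step S \<tau> A B \<longleftrightarrow> (\<exists>C\<in>producible S \<tau>. B \<in> comb \<tau> A C)"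

definition step_le1 :: "supertile set \<Rightarrow> nat \<Rightarrow> supertile \<Rightarrow> supertile \<Rightarrow> bool" where
  "step_le1 S \<tau> A B \<longleftrightarrow> A = B \<or> step S \<tau> A B"

abbreviation steps :: "supertile set \<Rightarrow> nat \<Rightarrow> supertile \<Rightarrow> supertile \<Rightarrow> bool" where
  "steps S \<tau> \<equiv> (step S \<tau>)\<^sup>*\<^sup>*"

text \<open>An m-block is a partial function on Z_m x Z_m; we represent it as a partial
  function on nat x nat that is undefined outside {0..<m} x {0..<m}.\<close>
type_synonym block = "nat \<times> nat \<Rightarrow> tile option"

definition block :: "nat \<Rightarrow> assembly \<Rightarrow> int \<Rightarrow> int \<Rightarrow> block" where
  "block m \<alpha> x y = (\<lambda>(i, j). if i < m \<and> j < m
       then \<alpha> (int m * x + int i, int m * y + int j) else None)"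

definition rep_fun :: "tile set \<Rightarrow> (block \<Rightarrow> tile option) \<Rightarrow> bool" where
  "rep_fun T R \<longleftrightarrow> (\<forall>b t. R b = Some t \<longrightarrow> t \<in> T)"

definition rep_star :: "nat \<Rightarrow> (block \<Rightarrow> tile option) \<Rightarrow> assembly \<Rightarrow> assembly" where
  "rep_star m R \<alpha> = (\<lambda>(x, y). R (block m \<alpha> x y))"

definition rep_super :: "nat \<Rightarrow> (block \<Rightarrow> tile option) \<Rightarrow> supertile \<Rightarrow> supertile" where
  "rep_super m R A = rep_star m R ` A"

definition nonempty_blocks :: "nat \<Rightarrow> assembly \<Rightarrow> pos set" where
  "nonempty_blocks m \<alpha> = {(x, y). block m \<alpha> x y \<noteq> (\<lambda>_. None)}"

definition maps_cleanly_asm :: "nat \<Rightarrow> (block \<Rightarrow> tile option) \<Rightarrow> assembly \<Rightarrow> bool" where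
  "maps_cleanly_asm m R \<alpha> \<longleftrightarrow>
     (\<forall>a\<in>nonempty_blocks m \<alpha>. \<forall>b\<in>nonempty_blocks m \<alpha>. a = b) \<or>
     (\<forall>(x, y)\<in>nonempty_blocks m \<alpha>.
        \<exists>(u, v)\<in>{(0, 0), (1, 0), (-1, 0), (0, 1), (0, -1)}.
          (x + u, y + v) \<in> dom (rep_star m R \<alpha>))"

definition maps_cleanly :: "tile set \<Rightarrow> nat \<Rightarrow> (block \<Rightarrow> tile option) \<Rightarrow> supertile \<Rightarrow> bool" where
  "maps_cleanly T m R A \<longleftrightarrow>
     supertile_over T (rep_super m R A) \<and> (\<forall>\<alpha>\<in>A. maps_cleanly_asm m R \<alpha>)"

definition simulates ::
  "supertile set \<Rightarrow> nat \<Rightarrow> tile set \<Rightarrow> supertile set \<Rightarrow> nat \<Rightarrow> nat \<Rightarrow> (block \<Rightarrow> tile option) \<Rightarrow> bool"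
where
  "simulates SU \<tau>' T S \<tau> m R \<longleftrightarrow>
     rep_fun T R \<and>
     \<comment> \<open>(i) equivalent productions\<close>
     rep_super m R ` producible SU \<tau>' = producible S \<tau> \<and>
     (\<forall>A\<in>producible SU \<tau>'. maps_cleanly T m R A) \<and>
     \<comment> \<open>(ii) T follows U\<close>
     (\<forall>A\<in>producible SU \<tau>'. \<forall>B\<in>producible SU \<tau>'.
        step SU \<tau>' A B \<longrightarrow> step_le1 S \<tau> (rep_super m R A) (rep_super m R B)) \<and>
     \<comment> \<open>(iii) U weakly models T\<close>
     (\<forall>A\<in>producible S \<tau>. \<forall>B\<in>producible S \<tau>. step S \<tau> A B \<longrightarrow>
        (\<forall>A'\<in>producible SU \<tau>'. rep_super m R A' = A \<longrightarrow>
           (\<exists>A''\<in>producible SU \<tau>'. rep_super m R A'' = A \<and> steps SU \<tau>' A' A'' \<and>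
              (\<exists>B'\<in>producible SU \<tau>'. rep_super m R B' = B \<and> step SU \<tau>' A'' B'))))"

end

theory Submission
  imports Defs
begin

text \<open>The simulated system has temperature 1. Its only assemblies are dominoes (``plugs'') of \<open>n\<close>
  types and an infinite vertical ``rack'' with hooks of \<open>n\<close> types that stick out to the east; a plug fits
  on exactly the free hooks of its own type. Initial supertiles of a simulator may be unstable, so a
  simulator can make a partner test arbitrarily many features at once, and counting bond strengths is
  of no use. What limits it is geometry: \<^emph>\<open>every\<close> translate of a simulator assembly has to map cleanly, not
  only those by multiples of \<open>m\<close>. A tile of a simulated rack that lies east of its hook, and a tile of a
  simulated plug that lies west of it, are therefore confined to essentially one row of tiles, so that
  the two touch in at most four tiles, whatever \<open>m\<close> is. With more than \<open>(|U| + 1) ^ 4\<close> types two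
  hooks of different types look the same to their plugs, and one of the plugs can be moved to the hook
  of the other, which is not a legal step of the simulated system.

  A partner could also represent a whole rack and interlock with the first one everywhere. Every
  such partner adds a tile to each band of \<open>m\<close> rows, and such a band has bounded capacity, so a rack that
  is as full as possible admits only plugs.\<close>

text \<open>Hook rows are spaced by doubling so that the rack has no translational symmetry, even up
  to finitely many cells; a grid in which a simulated rack is read thus stays valid when a finite
  partner attaches. The spine is infinite so that a simulated rack has a tile in every band of
  \<open>m\<close> rows. Types repeat along the rack, so free hooks of all types remain after
  finitely many attachments. Grids with different residues modulo \<open>m\<close> need not be
  related, so the geometry is done for any set of grid origins that meets all pairs of residues. If
  all their row bands share a row, it is unique, and the rack tile of a contact is next to the
  westernmost plug tile of that row, or is the tile of that row in the last column open to racks. If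
  they share none, there is at most one contact position for each of east, north and south. A moved
  plug needs a stable host, must not overlap it, and must find the same rack tiles at all its
  contacts. The westernmost plug tiles of two types may have different offsets, so a plug may also
  have to be shifted east, by a distance that need not be a multiple of \<open>m\<close>.\<close>

section \<open>Translations and supertiles\<close>

lemma translate_apply [simp]: "translate \<alpha> (a, b) (x, y) = \<alpha> (x - a, y - b)"
  by (simp add: translate_def)

lemma translate_translate: "translate (translate \<alpha> (a, b)) (c, d) = translate \<alpha> (a + c, b + d)"
  by (rule ext) (auto simp: translate_def algebra_simps)

lemma translate_0 [simp]: "translate \<alpha> (0, 0) = \<alpha>"
  by (rule ext) (auto simp: translate_def)

lemma translate_add: "translate (\<alpha> ++ \<beta>) v = translate \<alpha> v ++ translate \<beta> v"
  by (rule ext) (auto simp: translate_def map_add_def split: option.splits)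

lemma in_supertile_of_iff: "\<beta> \<in> supertile_of \<alpha> \<longleftrightarrow> (\<exists>a b. \<beta> = translate \<alpha> (a, b))"
  by (auto simp: supertile_of_def)

lemma supertile_of_translate [simp]: "supertile_of (translate \<alpha> v) = supertile_of \<alpha>"
proof (cases v)
  case (Pair a b)
  have "translate \<alpha> (c, d) = translate (translate \<alpha> (a, b)) (c - a, d - b)" for c d
    by (simp add: translate_translate)
  then show ?thesis
    unfolding Pair set_eq_iff in_supertile_of_iff by (metis translate_translate)
qed

lemma self_in_supertile_of [simp]: "\<alpha> \<in> supertile_of \<alpha>"
  unfolding in_supertile_of_iff by (metis translate_0)

lemma supertile_of_eq: "\<beta> \<in> supertile_of \<alpha> \<Longrightarrow> supertile_of \<beta> = supertile_of \<alpha>"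
  by (auto simp: in_supertile_of_iff)

lemma supertile_of_eq_iff:
  "supertile_of \<alpha> = supertile_of \<beta> \<longleftrightarrow> (\<exists>a b. \<alpha> = translate \<beta> (a, b))"
  by (metis in_supertile_of_iff self_in_supertile_of supertile_of_translate)

section \<open>Bonds, cuts and stability\<close>

lemma bond_pos_iff:
  "bond \<alpha> p q > 0 \<longleftrightarrow> (\<exists>t u. \<alpha> p = Some t \<and> \<alpha> q = Some u \<and>
     ((q = (fst p + 1, snd p) \<and> glueE t = glueW u \<and> snd (glueE t) > 0) \<or>
      (q = (fst p, snd p + 1) \<and> glueN t = glueS u \<and> snd (glueN t) > 0)))"
  by (auto simp: bond_def split: option.splits)

lemma bond_shift_cong:
  assumes "\<alpha> (x, y) = \<beta> (x + a, y + b)" "\<alpha> (x', y') = \<beta> (x' + a, y' + b)"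
  shows "bond \<alpha> (x, y) (x', y') = bond \<beta> (x + a, y + b) (x' + a, y' + b)"
  using assms by (auto simp: bond_def split: option.splits)

lemma bond_cong: "\<alpha> p = \<beta> p \<Longrightarrow> \<alpha> q = \<beta> q \<Longrightarrow> bond \<alpha> p q = bond \<beta> p q"
  by (simp add: bond_def)

text \<open>Dropping bonds of weight 0 leaves the sum unchanged and ties every remaining edge to two
  occupied adjacent cells.\<close>

definition cut_ge :: "nat \<Rightarrow> assembly \<Rightarrow> pos set \<Rightarrow> bool" where
  "cut_ge \<tau> \<alpha> C \<longleftrightarrow> (\<exists>F. finite F \<and> (\<forall>(p, q)\<in>F. bond \<alpha> p q > 0 \<and> (p \<in> C) \<noteq> (q \<in> C)) \<and>
     \<tau> \<le> (\<Sum>(p, q)\<in>F. bond \<alpha> p q))"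

lemma stable_iff_cut_ge:
  "stable \<tau> \<alpha> \<longleftrightarrow> (\<forall>C. C \<subseteq> dom \<alpha> \<and> C \<noteq> {} \<and> C \<noteq> dom \<alpha> \<longrightarrow> cut_ge \<tau> \<alpha> C)"
proof -
  have "cut_ge \<tau> \<alpha> C \<longleftrightarrow> (\<exists>F. finite F \<and> F \<subseteq> {(p, q). (p \<in> C \<and> q \<notin> C) \<or> (p \<notin> C \<and> q \<in> C)} \<and>
             \<tau> \<le> (\<Sum>(p, q)\<in>F. bond \<alpha> p q))" (is "_ \<longleftrightarrow> ?R") for C
  proof
    assume "cut_ge \<tau> \<alpha> C"
    then show ?R unfolding cut_ge_def by (elim exE) (rule exI, auto)
  next
    assume ?R
    then obtain F where F: "finite F" "F \<subseteq> {(p, q). (p \<in> C \<and> q \<notin> C) \<or> (p \<notin> C \<and> q \<in> C)}"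
      "\<tau> \<le> (\<Sum>(p, q)\<in>F. bond \<alpha> p q)" by blast
    let ?F = "{(p, q) \<in> F. bond \<alpha> p q > 0}"
    have "(\<Sum>(p, q)\<in>F. bond \<alpha> p q) = (\<Sum>(p, q)\<in>?F. bond \<alpha> p q)"
      using F(1) by (intro sum.mono_neutral_right) auto
    moreover have "finite ?F" using F(1) by (rule rev_finite_subset) auto
    ultimately show "cut_ge \<tau> \<alpha> C" using F unfolding cut_ge_def by (intro exI[of _ ?F]) auto
  qed
  then show ?thesis by (simp add: stable_def)
qed

lemma stableI:
  "(\<And>C. C \<subseteq> dom \<alpha> \<Longrightarrow> C \<noteq> {} \<Longrightarrow> C \<noteq> dom \<alpha> \<Longrightarrow> cut_ge \<tau> \<alpha> C) \<Longrightarrow> stable \<tau> \<alpha>"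
  by (simp add: stable_iff_cut_ge)

lemma stableD:
  "stable \<tau> \<alpha> \<Longrightarrow> C \<subseteq> dom \<alpha> \<Longrightarrow> C \<noteq> {} \<Longrightarrow> C \<noteq> dom \<alpha> \<Longrightarrow> cut_ge \<tau> \<alpha> C"
  by (simp add: stable_iff_cut_ge)

lemma cut_ge_1: "bond \<alpha> p q > 0 \<Longrightarrow> (p \<in> C) \<noteq> (q \<in> C) \<Longrightarrow> cut_ge 1 \<alpha> C"
  unfolding cut_ge_def by (intro exI[of _ "{(p, q)}"]) auto

lemma cut_ge_bond:
  assumes "cut_ge \<tau> \<alpha> C" "\<tau> \<ge> 1"
  shows "\<exists>p q. bond \<alpha> p q > 0 \<and> (p \<in> C) \<noteq> (q \<in> C)"
proof -
  obtain F where F: "\<forall>(p, q)\<in>F. bond \<alpha> p q > 0 \<and> (p \<in> C) \<noteq> (q \<in> C)"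
    "\<tau> \<le> (\<Sum>(p, q)\<in>F. bond \<alpha> p q)" using assms(1) unfolding cut_ge_def by blast
  have "F \<noteq> {}" using F(2) assms(2) by auto
  then obtain p q where "(p, q) \<in> F" by fastforce
  then show ?thesis using F(1) by blast
qed

text \<open>Translation is injective on edges, so the weight is carried over term by term. Only
  positive bonds across the cut are compared, so the two assemblies may differ elsewhere.\<close>

lemma cut_ge_transfer:
  assumes "cut_ge \<tau> \<alpha> C"
    and "\<And>x y x' y'. bond \<alpha> (x, y) (x', y') > 0 \<Longrightarrow> ((x, y) \<in> C) \<noteq> ((x', y') \<in> C) \<Longrightarrow>
      bond \<beta> (x + a, y + b) (x' + a, y' + b) = bond \<alpha> (x, y) (x', y') \<and>
      ((x + a, y + b) \<in> D) \<noteq> ((x' + a, y' + b) \<in> D)"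
  shows "cut_ge \<tau> \<beta> D"
proof -
  obtain F where F: "finite F" "\<And>p q. (p, q) \<in> F \<Longrightarrow> bond \<alpha> p q > 0 \<and> (p \<in> C) \<noteq> (q \<in> C)"
    "\<tau> \<le> (\<Sum>(p, q)\<in>F. bond \<alpha> p q)" using assms(1) unfolding cut_ge_def by blast
  define s where "s = (\<lambda>((x, y), (x', y')). ((x + a, y + b), (x' + a, y' + b)))"
  have inj: "inj_on s F" by (auto simp: inj_on_def s_def)
  have b: "bond \<beta> (fst (s e)) (snd (s e)) = bond \<alpha> (fst e) (snd e) \<and>
     (fst (s e) \<in> D) \<noteq> (snd (s e) \<in> D)" if "e \<in> F" for e
  proof -
    obtain x y x' y' where e: "e = ((x, y), (x', y'))" by (metis surj_pair)
    show ?thesis using assms(2)[of x y x' y'] F(2)[of "(x, y)" "(x', y')"] that by (simp add: e s_def)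
  qed
  have "(\<Sum>(p, q)\<in>s ` F. bond \<beta> p q) = (\<Sum>(p, q)\<in>F. bond \<alpha> p q)"
    unfolding sum.reindex[OF inj] comp_def case_prod_unfold by (intro sum.cong) (use b in auto)
  moreover have "bond \<beta> (fst e) (snd e) > 0 \<and> (fst e \<in> D) \<noteq> (snd e \<in> D)" if "e \<in> s ` F" for e
  proof -
    obtain e' where "e' \<in> F" "e = s e'" using \<open>e \<in> s ` F\<close> by blast
    then show ?thesis using b[of e'] F(2)[of "fst e'" "snd e'"] by simp
  qed
  then have "\<forall>(p, q)\<in>s ` F. bond \<beta> p q > 0 \<and> (p \<in> D) \<noteq> (q \<in> D)"
    unfolding case_prod_unfold by blast
  ultimately show ?thesis unfolding cut_ge_def using F(1,3) by (intro exI[of _ "s ` F"]) auto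
qed

lemma stable_translate: 
  assumes "stable \<tau> \<alpha>"
  shows "stable \<tau> (translate \<alpha> v)"
proof -
  obtain a b where v: "v = (a, b)" by fastforce
  have "cut_ge \<tau> (translate \<alpha> v) D" if D: "D \<subseteq> dom (translate \<alpha> v)" "D \<noteq> {}" "D \<noteq> dom (translate \<alpha> v)" for D
  proof -
    let ?C = "{(x, y). (x + a, y + b) \<in> D}"
    have mem: "(x, y) \<in> D \<longleftrightarrow> (x - a, y - b) \<in> ?C" for x y by simp
    have "?C \<subseteq> dom \<alpha>"
    proof (clarify)
      fix x y assume "(x + a, y + b) \<in> D"
      then have "(x + a, y + b) \<in> dom (translate \<alpha> v)" using D(1) by blast
      then show "\<exists>t. \<alpha> (x, y) = Some t" by (simp add: v domIff)
    qed
    moreover have "?C \<noteq> {}" using D(2) mem by fastforce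
    moreover have "?C \<noteq> dom \<alpha>"
    proof
      assume "?C = dom \<alpha>"
      then have "(x, y) \<in> D \<longleftrightarrow> (x - a, y - b) \<in> dom \<alpha>" for x y using mem by blast
      then have "D = dom (translate \<alpha> v)" by (auto simp: v domIff)
      then show False using D(3) by blast
    qed
    ultimately have "cut_ge \<tau> \<alpha> ?C" by (intro stableD[OF assms])
    then show ?thesis
      by (rule cut_ge_transfer[where a = a and b = b]) (auto simp: v intro: bond_shift_cong[symmetric])
  qed
  then show ?thesis by (rule stableI)
qed

lemma bond_pos_dom: "bond \<alpha> p q > 0 \<Longrightarrow> p \<in> dom \<alpha> \<and> q \<in> dom \<alpha>"
  by (auto simp: bond_pos_iff)

text \<open>The partner \<open>\<gamma>\<close> need not be stable itself. A cut of the new union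
  either splits \<open>\<alpha>\<close>, whose own bonds then suffice, or has one side inside the
  moved partner; in \<open>\<alpha>1 ++ \<gamma>\<close> the bonds across the corresponding cut
  involve only partner tiles and contact tiles, and all of these reappear.\<close>

lemma stable_partner_transfer:
  assumes st1: "stable \<tau> (\<alpha>1 ++ \<gamma>)" and dis1: "dom \<alpha>1 \<inter> dom \<gamma> = {}" and ne: "dom \<alpha>1 \<noteq> {}"
    and st: "stable \<tau> \<alpha>" and dis: "dom \<alpha> \<inter> dom (translate \<gamma> (a, b)) = {}"
    and contact: "\<And>x y x' y'. (x, y) \<in> dom \<alpha>1 \<Longrightarrow> (x', y') \<in> dom \<gamma> \<Longrightarrow>
       bond (\<alpha>1 ++ \<gamma>) (x, y) (x', y') > 0 \<or> bond (\<alpha>1 ++ \<gamma>) (x', y') (x, y) > 0 \<Longrightarrow>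
       \<alpha> (x + a, y + b) = \<alpha>1 (x, y)"
  shows "stable \<tau> (\<alpha> ++ translate \<gamma> (a, b))"
proof -
  let ?g = "translate \<gamma> (a, b)"
  let ?u = "\<alpha> ++ ?g"
  have gdom: "(x + a, y + b) \<in> dom ?g \<longleftrightarrow> (x, y) \<in> dom \<gamma>" for x y by (simp add: domIff)
  have rel: "cut_ge \<tau> ?u D" if D: "D \<subseteq> dom ?g" "D \<noteq> {}" for D
  proof -
    define C where "C = {(x, y). (x + a, y + b) \<in> D}"
    have mem: "(x, y) \<in> C \<longleftrightarrow> (x + a, y + b) \<in> D" for x y by (simp add: C_def)
    have sub: "C \<subseteq> dom \<gamma>"
    proof
      fix p assume "p \<in> C"
      then show "p \<in> dom \<gamma>" using D(1) gdom mem by (cases p) blast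
    qed
    obtain x0 y0 where "(x0, y0) \<in> D" using D(2) by fastforce
    then have "(x0 - a, y0 - b) \<in> C" by (simp add: mem)
    then have "C \<noteq> {}" by blast
    moreover have "C \<subseteq> dom (\<alpha>1 ++ \<gamma>)" using sub by auto
    moreover obtain p where "p \<in> dom \<alpha>1" using ne by blast
    then have "p \<in> dom (\<alpha>1 ++ \<gamma>)" "p \<notin> C" using sub dis1 by auto
    then have "C \<noteq> dom (\<alpha>1 ++ \<gamma>)" by blast
    ultimately have "cut_ge \<tau> (\<alpha>1 ++ \<gamma>) C" by (intro stableD[OF st1])
    then show ?thesis
    proof (rule cut_ge_transfer[where a = a and b = b])
      fix x y x' y'
      assume pos: "bond (\<alpha>1 ++ \<gamma>) (x, y) (x', y') > 0" and cr: "((x, y) \<in> C) \<noteq> ((x', y') \<in> C)"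
      have d: "(x, y) \<in> dom \<alpha>1 \<union> dom \<gamma>" "(x', y') \<in> dom \<alpha>1 \<union> dom \<gamma>"
        using bond_pos_dom[OF pos] by auto
      have g: "?u (z + a, w + b) = (\<alpha>1 ++ \<gamma>) (z, w)" if "(z, w) \<in> dom \<gamma>" for z w
        using that by (auto simp: map_add_dom_app_simps(1) domIff map_add_def split: option.splits)
      have al: "?u (z + a, w + b) = (\<alpha>1 ++ \<gamma>) (z, w)"
        if "(z, w) \<in> dom \<alpha>1" "\<alpha> (z + a, w + b) = \<alpha>1 (z, w)" for z w
      proof -
        have "(z, w) \<notin> dom \<gamma>" using that(1) dis1 by blast
        then show ?thesis using that by (auto simp: map_add_def domIff)
      qed
      have "(x, y) \<in> dom \<gamma> \<or> (x', y') \<in> dom \<gamma>" using cr sub by blast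
      then have "?u (x + a, y + b) = (\<alpha>1 ++ \<gamma>) (x, y) \<and> ?u (x' + a, y' + b) = (\<alpha>1 ++ \<gamma>) (x', y')"
        using d g[of x y] g[of x' y'] al[of x y] al[of x' y'] contact[of x y x' y'] contact[of x' y' x y] pos
        by blast
      then show "bond ?u (x + a, y + b) (x' + a, y' + b) = bond (\<alpha>1 ++ \<gamma>) (x, y) (x', y') \<and>
          ((x + a, y + b) \<in> D) \<noteq> ((x' + a, y' + b) \<in> D)"
        using bond_shift_cong[of "\<alpha>1 ++ \<gamma>" x y ?u a b x' y'] cr mem by auto
    qed
  qed
  have "cut_ge \<tau> ?u C" if C: "C \<subseteq> dom ?u" "C \<noteq> {}" "C \<noteq> dom ?u" for C
  proof -
    consider "C \<inter> dom \<alpha> \<noteq> {}" "C \<inter> dom \<alpha> \<noteq> dom \<alpha>" | "C \<inter> dom \<alpha> = {}" | "dom \<alpha> \<subseteq> C" by blast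
    then show ?thesis
    proof cases
      case 1
      then have "cut_ge \<tau> \<alpha> (C \<inter> dom \<alpha>)" by (intro stableD[OF st]) auto
      then show ?thesis
      proof (rule cut_ge_transfer[where a = 0 and b = 0], goal_cases)
        case (1 x y x' y')
        have "(x, y) \<in> dom \<alpha>" "(x', y') \<in> dom \<alpha>" using bond_pos_dom[OF 1(1)] by auto
        moreover have "?u p = \<alpha> p" if "p \<in> dom \<alpha>" for p
          using that dis by (metis disjoint_iff map_add_dom_app_simps(3))
        ultimately show ?case using 1 by (auto simp: intro!: bond_cong)
      qed
    next
      case 2
      then have "C \<subseteq> dom ?g" using C(1) by auto
      then show ?thesis using C(2) by (rule rel)
    next
      case 3
      let ?D = "dom ?u - C"
      have "?D \<subseteq> dom ?g" "?D \<noteq> {}" using 3 C(1,3) by auto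
      then have "cut_ge \<tau> ?u ?D" by (rule rel)
      then show ?thesis
      proof (rule cut_ge_transfer[where a = 0 and b = 0], goal_cases)
        case (1 x y x' y')
        then show ?case using bond_pos_dom[OF 1(1)] by auto
      qed
    qed
  qed
  then show ?thesis by (rule stableI)
qed

subsection \<open>The simulated system\<close>

text \<open>Unary labels make different numbers different glues. Label 0 runs along the spine and 1
  holds the hooks; for type \<open>j\<close> the even label \<open>2 * j + 2\<close> joins hook to
  plug and the odd label \<open>2 * j + 3\<close> joins the two halves of the plug.\<close>

definition gl :: "nat \<Rightarrow> glue" where "gl k = (replicate k (CHR ''x''), 1)"
definition nogl :: glue where "nogl = ([], 0)"

lemma gl_simps [simp]: "gl k = gl l \<longleftrightarrow> k = l" "snd (gl k) = 1" "snd nogl = 0" "gl k \<noteq> nogl" "nogl \<noteq> gl k"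
  by (auto simp: gl_def nogl_def dest: arg_cong[of _ _ length])

definition spine :: tile where "spine = Tile (gl 0) nogl (gl 0) nogl"
definition joint :: tile where "joint = Tile (gl 0) (gl 1) (gl 0) nogl"
definition hook :: "nat \<Rightarrow> tile" where "hook j = Tile nogl (gl (2 * j + 2)) nogl (gl 1)"
definition plugL :: "nat \<Rightarrow> tile" where "plugL j = Tile nogl (gl (2 * j + 3)) nogl (gl (2 * j + 2))"
definition plugR :: "nat \<Rightarrow> tile" where "plugR j = Tile nogl nogl nogl (gl (2 * j + 3))"

lemmas tile_defs = spine_def joint_def hook_def plugL_def plugR_def

lemma tile_distinct [simp]:
  "spine \<noteq> joint" "spine \<noteq> hook j" "spine \<noteq> plugL j" "spine \<noteq> plugR j"
  "joint \<noteq> hook j" "joint \<noteq> plugL j" "joint \<noteq> plugR j" "hook i \<noteq> plugL j" "hook i \<noteq> plugR j"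
  "plugL i \<noteq> plugR j"
  "joint \<noteq> spine" "hook j \<noteq> spine" "plugL j \<noteq> spine" "plugR j \<noteq> spine"
  "hook j \<noteq> joint" "plugL j \<noteq> joint" "plugR j \<noteq> joint" "plugL j \<noteq> hook i" "plugR j \<noteq> hook i"
  "plugR j \<noteq> plugL i"
  "hook i = hook j \<longleftrightarrow> i = j" "plugL i = plugL j \<longleftrightarrow> i = j" "plugR i = plugR j \<longleftrightarrow> i = j"
  by (auto simp: tile_defs)

section \<open>Geometry of racks and plugs\<close>

text \<open>The factor 4 keeps other hook rows out of distance 3 of a given one, as needed for cells
  next to cells near a hook. The doubling destroys translational symmetry.\<close>

definition row :: "nat \<Rightarrow> int" where "row k = 4 * 2 ^ k"

lemma row_less: "k < l \<Longrightarrow> 2 * row k \<le> row l"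
proof -
  assume "k < l"
  then have "(2::int) ^ Suc k \<le> 2 ^ l" by (intro power_increasing) auto
  then show ?thesis by (simp add: row_def)
qed

lemma row_ge: "row k \<ge> 4" by (simp add: row_def)

lemma row_gap: "k \<noteq> l \<Longrightarrow> row k + 4 \<le> row l \<or> row l + 4 \<le> row k"
  using row_less[of k l] row_less[of l k] row_ge[of k] row_ge[of l] by linarith

lemma row_inject [simp]: "row k = row l \<longleftrightarrow> k = l"
  using row_gap[of k l] by force

text \<open>The nearest other hook row is at least half of \<open>row k\<close> away, too far for
  \<open>z\<close>.\<close>

lemma row_shift:
  assumes "2 * \<bar>z\<bar> < row k" "row k + z = row l"
  shows "z = 0"
proof -
  consider "k < l" | "l < k" | "k = l" by linarith
  then show ?thesis
    by cases (use row_less[of k l] row_less[of l k] assms in \<open>auto\<close>)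
qed

text \<open>\<open>I\<close> is the set of hooks that carry a plug. For positive \<open>n\<close>,
  the types \<open>k mod n\<close> each occur infinitely often.\<close>

definition rack :: "nat \<Rightarrow> nat set \<Rightarrow> assembly" where
  "rack n I = (\<lambda>(x, y). if x = 0 then Some (if y \<in> range row then joint else spine)
     else if y \<in> range row then
       (let k = inv row y in
        if x = 1 then Some (hook (k mod n)) else if x = 2 \<and> k \<in> I then Some (plugL (k mod n))
        else if x = 3 \<and> k \<in> I then Some (plugR (k mod n)) else None)
     else None)"

definition plug :: "nat \<Rightarrow> assembly" where
  "plug j = (\<lambda>p. if p = (0, 0) then Some (plugL j) else if p = (1, 0) then Some (plugR j) else None)"

lemma inv_row [simp]: "inv row (row k) = k"
  by (simp add: inv_f_f inj_def)

lemma rack_Some_iff: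
  "rack n I (x, y) = Some t \<longleftrightarrow> (x = 0 \<and> t = (if y \<in> range row then joint else spine)) \<or>
     (\<exists>k. y = row k \<and> (x = 1 \<and> t = hook (k mod n) \<or> x = 2 \<and> k \<in> I \<and> t = plugL (k mod n) \<or>
        x = 3 \<and> k \<in> I \<and> t = plugR (k mod n)))"
  by (auto simp: rack_def Let_def)

lemma rack_spine [simp]: "rack n I (0, y) = Some (if y \<in> range row then joint else spine)"
  and rack_row [simp]: "rack n I (1, row k) = Some (hook (k mod n))"
    "rack n I (2, row k) = (if k \<in> I then Some (plugL (k mod n)) else None)"
    "rack n I (3, row k) = (if k \<in> I then Some (plugR (k mod n)) else None)"
  by (auto simp: rack_def)

lemma in_dom_rack_iff:
  "(x, y) \<in> dom (rack n I) \<longleftrightarrow> x = 0 \<or> (\<exists>k. y = row k \<and> (x = 1 \<or> (x = 2 \<or> x = 3) \<and> k \<in> I))"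
  by (auto simp: dom_def rack_Some_iff)

lemma plug_Some_iff:
  "plug j p = Some t \<longleftrightarrow> p = (0, 0) \<and> t = plugL j \<or> p = (1, 0) \<and> t = plugR j"
  by (auto simp: plug_def)

lemma dom_plug: "dom (plug j) = {(0, 0), (1, 0)}"
  by (auto simp: plug_Some_iff dom_def)

lemma rack_add_plug:
  assumes "k \<notin> I" 
  shows "rack n I ++ translate (plug (k mod n)) (2, row k) = rack n (insert k I)"
proof (rule ext)
  fix p :: pos
  obtain x y where p: "p = (x, y)" by fastforce
  show "(rack n I ++ translate (plug (k mod n)) (2, row k)) p = rack n (insert k I) p"
    unfolding p by (auto simp: map_add_def plug_def rack_def Let_def split: option.splits)
qed

text \<open>Far below, outside \<open>B\<close>, there are no hooks and the rack is the bare spine,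
  which forces \<open>a = 0\<close>. Far above, a joint can land on another joint only by a shift
  comparable to its height, which forces \<open>b = 0\<close>.\<close>

lemma rack_almost_shift:
  assumes "finite B" and eq: "\<And>x y. (x, y) \<notin> B \<Longrightarrow> rack n I' (x, y) = rack n I (x + a, y + b)"
  shows "a = 0 \<and> b = 0"
proof -
  have fin: "finite (snd ` B)" using assms(1) by simp
  obtain M where M: "\<And>y. y \<in> snd ` B \<Longrightarrow> \<bar>y\<bar> < M"
  proof -
    have "finite (abs ` snd ` B)" using fin by simp
    then obtain M where "\<forall>y\<in>abs ` snd ` B. y < M"
      by (metis finite_has_maximal2 linorder_not_less finite.emptyI empty_iff Max_ge le_less_trans zless_add1_eq less_add_one)
    then show ?thesis using that by blast
  qed
  have off: "(x, y) \<notin> B" if "\<bar>y\<bar> \<ge> M" for x y using M[of y] that by force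
  have a: "a = 0"
  proof -
    let ?y = "- \<bar>M\<bar> - \<bar>b\<bar>"
    have "(0, ?y) \<notin> B" by (rule off) linarith
    then have "rack n I (a, ?y + b) \<noteq> None" using eq[of 0 ?y] by (metis add_0 option.distinct(1) rack_spine)
    then have "(a, ?y + b) \<in> dom (rack n I)" by auto
    then show ?thesis unfolding in_dom_rack_iff using row_ge by (smt (verit))
  qed
  obtain k where k: "nat (\<bar>M\<bar> + 2 * \<bar>b\<bar>) < 2 ^ k" using less_exp by blast
  have k': "\<bar>M\<bar> + 2 * \<bar>b\<bar> < row k"
  proof -
    have "int (nat (\<bar>M\<bar> + 2 * \<bar>b\<bar>)) < int (2 ^ k)" using k by linarith
    then show ?thesis by (simp add: row_def)
  qed
  have "rack n I (0, row k + b) = Some joint"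
  proof -
    have "(0, row k) \<notin> B" by (rule off) (use k' in linarith)
    then show ?thesis using eq[of 0 "row k"] a by simp
  qed
  then obtain l where "row k + b = row l" by (auto split: if_splits)
  then have "b = 0" using row_shift[of b k l] k' by linarith
  with a show ?thesis by simp
qed

lemma rack_supertile_inject:
  assumes "supertile_of (rack n I) = supertile_of (rack n I')"
  shows "I = I'"
proof -
  obtain a b where ab: "rack n I = translate (rack n I') (a, b)"
    using assms supertile_of_eq_iff by blast
  then have "rack n I (x, y) = rack n I' (x + - a, y + - b)" for x y by simp
  then have "- a = 0 \<and> - b = 0" by (intro rack_almost_shift[of "{}"]) auto
  then have eq: "rack n I = rack n I'" using ab by simp
  show ?thesis
  proof (rule set_eqI)
    fix k
    show "k \<in> I \<longleftrightarrow> k \<in> I'" using fun_cong[OF eq, of "(2, row k)"] by (auto split: if_splits)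
  qed
qed

lemma rack_connected:
  assumes inv: "\<And>p q. bond (rack n I) p q > 0 \<Longrightarrow> p \<in> C \<longleftrightarrow> q \<in> C"
    and p: "p \<in> dom (rack n I)"
  shows "p \<in> C \<longleftrightarrow> (0, 0) \<in> C"
proof -
  have up: "(0, y) \<in> C \<longleftrightarrow> (0, y + 1) \<in> C" for y
    by (rule inv) (auto simp: bond_pos_iff tile_defs)
  have spine: "(0, y) \<in> C \<longleftrightarrow> (0, 0) \<in> C" for y :: int
  proof (induction y rule: int_induct[where k = 0])
    case (step2 i) then show ?case using up[of "i - 1"] by simp
  qed (use up in auto)
  have h: "(1, row k) \<in> C \<longleftrightarrow> (0, row k) \<in> C" for k
    by (rule inv[symmetric]) (auto simp: bond_pos_iff tile_defs)
  have l: "(2, row k) \<in> C \<longleftrightarrow> (1, row k) \<in> C" if "k \<in> I" for k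
    by (rule inv[symmetric]) (use that in \<open>auto simp: bond_pos_iff tile_defs\<close>)
  have r: "(3, row k) \<in> C \<longleftrightarrow> (2, row k) \<in> C" if "k \<in> I" for k
    by (rule inv[symmetric]) (use that in \<open>auto simp: bond_pos_iff tile_defs\<close>)
  obtain x y where "p = (x, y)" by fastforce
  then show ?thesis using p spine h l r in_dom_rack_iff[of x y n I] by auto
qed

lemma stable_rack: "stable 1 (rack n I)"
proof (rule stableI)
  fix C assume C: "C \<subseteq> dom (rack n I)" "C \<noteq> {}" "C \<noteq> dom (rack n I)"
  show "cut_ge 1 (rack n I) C"
  proof (rule ccontr)
    assume "\<not> cut_ge 1 (rack n I) C"
    then have "p \<in> C \<longleftrightarrow> q \<in> C" if "bond (rack n I) p q > 0" for p q
      using cut_ge_1[OF that] by blast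
    then have "p \<in> C \<longleftrightarrow> (0, 0) \<in> C" if "p \<in> dom (rack n I)" for p
      using rack_connected that by blast
    then show False using C by blast
  qed
qed

lemma glue_simps [simp]:
  "glueN spine = gl 0" "glueS spine = gl 0" "glueE spine = nogl" "glueW spine = nogl"
  "glueN joint = gl 0" "glueS joint = gl 0" "glueE joint = gl 1" "glueW joint = nogl"
  "glueN (hook j) = nogl" "glueS (hook j) = nogl" "glueE (hook j) = gl (2 * j + 2)" "glueW (hook j) = gl 1"
  "glueN (plugL j) = nogl" "glueS (plugL j) = nogl" "glueE (plugL j) = gl (2 * j + 3)"
  "glueW (plugL j) = gl (2 * j + 2)"
  "glueN (plugR j) = nogl" "glueS (plugR j) = nogl" "glueE (plugR j) = nogl" "glueW (plugR j) = gl (2 * j + 3)"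
  by (simp_all add: tile_defs)

definition parts :: "nat \<Rightarrow> assembly set" where
  "parts n = {translate (rack n I) (a, b) | I a b. True} \<union> {translate (plug j) (a, b) | j a b. j < n}"

lemma rack_in_parts [simp]: "translate (rack n I) v \<in> parts n" "rack n I \<in> parts n"
  and plug_in_parts [simp]: "j < n \<Longrightarrow> translate (plug j) v \<in> parts n" "j < n \<Longrightarrow> plug j \<in> parts n"
proof -
  show 1: "translate (rack n I) v \<in> parts n" for v by (cases v) (auto simp: parts_def)
  show 2: "translate (plug j) v \<in> parts n" if "j < n" for v using that by (cases v) (unfold parts_def, blast)
  show "rack n I \<in> parts n" using 1[of "(0, 0)"] by simp
  show "plug j \<in> parts n" if "j < n" using 2[of "(0, 0)"] that by simp
qed

text \<open>Every glue of a part except the east glue of a free hook and the west glue of a plug is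
  already covered by a tile of the same part.\<close>
lemma parts_bond:
  assumes \<alpha>: "\<alpha> \<in> parts n" and \<beta>: "\<beta> \<in> parts n" and dis: "dom \<alpha> \<inter> dom \<beta> = {}"
    and p: "p \<in> dom \<alpha>" and q: "q \<in> dom \<beta>" and bond: "bond (\<alpha> ++ \<beta>) p q > 0"
  shows "\<exists>I k a b. k \<notin> I \<and> \<alpha> = translate (rack n I) (a, b) \<and>
     \<beta> = translate (translate (plug (k mod n)) (2, row k)) (a, b)"
proof -
  have val: "(\<alpha> ++ \<beta>) p = \<alpha> p" "(\<alpha> ++ \<beta>) q = \<beta> q"
    using dis p q map_add_dom_app_simps(1)[of q \<beta> \<alpha>] map_add_dom_app_simps(3)[of p \<beta> \<alpha>] by blast+
  obtain x y where xy: "p = (x, y)" by fastforce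
  obtain t u where tu: "\<alpha> p = Some t" "\<beta> q = Some u"
    and d: "(q = (x + 1, y) \<and> glueE t = glueW u \<and> snd (glueE t) > 0) \<or>
      (q = (x, y + 1) \<and> glueN t = glueS u \<and> snd (glueN t) > 0)"
  proof -
    obtain t u where tu: "(\<alpha> ++ \<beta>) p = Some t \<and> (\<alpha> ++ \<beta>) q = Some u \<and>
      ((q = (fst p + 1, snd p) \<and> glueE t = glueW u \<and> snd (glueE t) > 0) \<or>
       (q = (fst p, snd p + 1) \<and> glueN t = glueS u \<and> snd (glueN t) > 0))"
      using bond unfolding bond_pos_iff by (elim exE)
    show ?thesis by (rule that[of t u]) (use tu val in \<open>auto simp: xy\<close>)
  qed
  have clash: False if "\<alpha> z = Some t'" "\<beta> z = Some u'" for z t' u' using that dis by auto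
  have \<alpha>E: "\<exists>t'. \<alpha> (x + 1, y) = Some t'" if "t = joint \<or> (\<exists>j. t = plugL j)"
    using \<alpha> tu(1) that unfolding parts_def xy
    by (auto simp: rack_Some_iff plug_Some_iff split: if_splits) 
  have \<alpha>N: "\<exists>t'. \<alpha> (x, y + 1) = Some t'" if "t = joint \<or> t = spine"
    using \<alpha> tu(1) that unfolding parts_def xy
    by (auto simp: rack_Some_iff plug_Some_iff split: if_splits)
  have ty: "t = spine \<or> t = joint \<or> (\<exists>j. t = hook j) \<or> (\<exists>j. t = plugL j) \<or> (\<exists>j. t = plugR j)"
    using \<alpha> tu(1) unfolding parts_def xy by (auto simp: rack_Some_iff plug_Some_iff split: if_splits)
  have uy: "u = spine \<or> u = joint \<or> (\<exists>j. u = hook j) \<or> (\<exists>j. u = plugL j) \<or> (\<exists>j. u = plugR j)"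
    using \<beta> tu(2) unfolding parts_def by (cases q) (auto simp: rack_Some_iff plug_Some_iff split: if_splits)
  from d show ?thesis
  proof
    assume "q = (x, y + 1) \<and> glueN t = glueS u \<and> snd (glueN t) > 0"
    then have "q = (x, y + 1)" "t = joint \<or> t = spine" using ty by auto
    then show ?thesis using \<alpha>N clash tu(2) by blast
  next
    assume E: "q = (x + 1, y) \<and> glueE t = glueW u \<and> snd (glueE t) > 0"
    then have "t \<noteq> joint" "\<And>j. t \<noteq> plugL j" using \<alpha>E clash tu(2) by blast+
    then obtain j where j: "t = hook j" using ty E by auto
    then have u: "u = plugL j" using uy E by auto presburger+
    obtain I a b where \<alpha>': "\<alpha> = translate (rack n I) (a, b)"
      using \<alpha> tu(1) j unfolding parts_def xy by (auto simp: plug_Some_iff)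
    have "rack n I (x - a, y - b) = Some (hook j)" using tu(1) j \<alpha>' xy by simp
    then obtain k where k: "x - a = 1" "y - b = row k" "j = k mod n"
      by (auto simp: rack_Some_iff split: if_splits)
    have nr: "\<beta> \<noteq> translate (rack n I') (a', b')" for I' a' b'
    proof
      assume \<beta>': "\<beta> = translate (rack n I') (a', b')"
      then have "rack n I' (x + 1 - a', y - b') = Some (plugL j)" using tu(2) u E by simp
      then obtain k' where "x + 1 - a' = 2" "y - b' = row k'"
        by (auto simp: rack_Some_iff split: if_splits)
      then have "\<beta> (x, y) = Some (hook (k' mod n))" using \<beta>' by simp
      then show False using clash tu(1) xy by blast
    qed
    then obtain j' a' b' where \<beta>': "\<beta> = translate (plug j') (a', b')"
      using \<beta> unfolding parts_def by blast
    then have "plug j' (x + 1 - a', y - b') = Some (plugL j)" using tu(2) u E by simp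
    then have "a' = x + 1" "b' = y" "j' = j" by (auto simp: plug_Some_iff)
    then have 1: "\<beta> = translate (translate (plug (k mod n)) (2, row k)) (a, b)"
      using \<beta>' k by (simp add: translate_translate algebra_simps)
    have "k \<notin> I"
    proof
      assume "k \<in> I"
      then have "\<alpha> (x + 1, y) = Some (plugL j)" using \<alpha>' k by (simp add: algebra_simps)
      then show False using clash tu(2) E by blast
    qed
    then show ?thesis using 1 \<alpha>' by blast
  qed
qed

lemma dom_parts_ne: "\<alpha> \<in> parts n \<Longrightarrow> dom \<alpha> \<noteq> {}"
proof
  assume "\<alpha> \<in> parts n" and e: "dom \<alpha> = {}"
  then consider I a b where "\<alpha> = translate (rack n I) (a, b)" | j a b where "\<alpha> = translate (plug j) (a, b)"
    unfolding parts_def by blast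
  then show False
  proof cases
    case 1 then have "\<alpha> (a, b) \<noteq> None" by simp
    then show False using e by auto
  next
    case 2 then have "\<alpha> (a, b) \<noteq> None" by (simp add: plug_def)
    then show False using e by auto
  qed
qed

text \<open>Stability yields a bond between the two parts, and the only glues left uncovered are
  those of free hooks and plugs. Bonds are oriented, so either part may turn out to be the
  rack.\<close>

lemma parts_combine:
  assumes \<alpha>: "\<alpha> \<in> parts n" and \<beta>: "\<beta> \<in> parts n" and dis: "dom \<alpha> \<inter> dom \<beta> = {}"
    and st: "stable 1 (\<alpha> ++ \<beta>)"
  shows "\<exists>I k a b. k \<notin> I \<and> \<alpha> ++ \<beta> = translate (rack n (insert k I)) (a, b) \<and>
     {\<alpha>, \<beta>} = {translate (rack n I) (a, b), translate (translate (plug (k mod n)) (2, row k)) (a, b)}"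
proof -
  have "dom \<beta> \<noteq> dom (\<alpha> ++ \<beta>)" using dom_parts_ne[OF \<alpha>] dis unfolding dom_map_add by blast
  then have "cut_ge 1 (\<alpha> ++ \<beta>) (dom \<beta>)"
    using dom_parts_ne[OF \<beta>] by (intro stableD[OF st]) auto
  then obtain p q where pq: "bond (\<alpha> ++ \<beta>) p q > 0" "(p \<in> dom \<beta>) \<noteq> (q \<in> dom \<beta>)"
    using cut_ge_bond by blast
  have comm: "\<alpha> ++ \<beta> = \<beta> ++ \<alpha>" by (rule map_add_comm[OF dis])
  have d: "p \<in> dom \<alpha> \<union> dom \<beta>" "q \<in> dom \<alpha> \<union> dom \<beta>" using bond_pos_dom[OF pq(1)] by auto
  have add: "translate (rack n I) (a, b) ++ translate (translate (plug (k mod n)) (2, row k)) (a, b) =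
     translate (rack n (insert k I)) (a, b)" if "k \<notin> I" for I k a b
    using rack_add_plug[OF that, of n] by (simp flip: translate_add)
  show ?thesis
  proof (cases "p \<in> dom \<alpha>")
    case True
    then have "q \<in> dom \<beta>" using pq(2) d dis by blast
    then obtain I k a b where "k \<notin> I" "\<alpha> = translate (rack n I) (a, b)"
      "\<beta> = translate (translate (plug (k mod n)) (2, row k)) (a, b)"
      using parts_bond[OF \<alpha> \<beta> dis True _ pq(1)] by blast
    then show ?thesis using add by metis
  next
    case False
    then have "p \<in> dom \<beta>" "q \<in> dom \<alpha>" using pq(2) d by auto
    then obtain I k a b where "k \<notin> I" "\<beta> = translate (rack n I) (a, b)"
      "\<alpha> = translate (translate (plug (k mod n)) (2, row k)) (a, b)"
      using parts_bond[OF \<beta> \<alpha> _ _ _ pq(1)[unfolded comm]] dis by blast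
    then show ?thesis using add[of k I a b] comm
      by (intro exI[of _ I] exI[of _ k] exI[of _ a] exI[of _ b]) (simp add: insert_commute)
  qed
qed

section \<open>Producible supertiles and steps of the simulated system\<close>

definition target_tiles :: "nat \<Rightarrow> tile set" where
  "target_tiles n = {spine, joint} \<union> hook ` {..<n} \<union> plugL ` {..<n} \<union> plugR ` {..<n}"

definition target_init :: "nat \<Rightarrow> supertile set" where
  "target_init n = insert (supertile_of (rack n {})) ((\<lambda>j. supertile_of (plug j)) ` {..<n})"

lemma chain_limit_eq:
  assumes "\<And>n. f n \<subseteq>\<^sub>m g" "\<And>p. g p \<noteq> None \<Longrightarrow> \<exists>n. f n p \<noteq> None"
  shows "chain_limit f = g"
proof (rule ext)
  fix p
  show "chain_limit f p = g p"
  proof (cases "\<exists>n. f n p \<noteq> None")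
    case True
    then have "f (LEAST n. f n p \<noteq> None) p \<noteq> None" by (rule LeastI_ex)
    then have "f (LEAST n. f n p \<noteq> None) p = g p" using assms(1) unfolding map_le_def by blast
    then show ?thesis using True by (simp add: chain_limit_def)
  next
    case False
    then have "g p = None" using assms(2)[of p] by blast
    with False show ?thesis by (simp add: chain_limit_def)
  qed
qed

lemma rack_mono: "I \<subseteq> J \<Longrightarrow> rack n I \<subseteq>\<^sub>m rack n J"
proof -
  assume IJ: "I \<subseteq> J"
  have "rack n J (x, y) = Some t" if "rack n I (x, y) = Some t" for x y t
    using that IJ unfolding rack_Some_iff by blast
  then show ?thesis unfolding map_le_def by (metis domD surj_pair)
qed

lemma translate_mono: "\<alpha> \<subseteq>\<^sub>m \<beta> \<Longrightarrow> translate \<alpha> v \<subseteq>\<^sub>m translate \<beta> v"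
  unfolding map_le_def by (auto simp: translate_def domIff)

lemma parts_subset_translate:
  "supertile_of \<alpha> \<in> supertile_of ` parts n \<Longrightarrow> \<alpha> \<in> parts n"
proof -
  assume "supertile_of \<alpha> \<in> supertile_of ` parts n"
  then obtain \<beta> a b where b: "\<beta> \<in> parts n" "\<alpha> = translate \<beta> (a, b)"
    using supertile_of_eq_iff by blast
  then consider I c d where "\<beta> = translate (rack n I) (c, d)" | j c d where "j < n" "\<beta> = translate (plug j) (c, d)"
    unfolding parts_def by blast
  then show ?thesis by cases (simp_all add: b(2) translate_translate)
qed

text \<open>An infinite sequence adds plugs to a rack in a fixed position, so its limit is the rack
  whose plug set is the union.\<close>

lemma target_producible_parts:
  "A \<in> producible (target_init n) 1 \<Longrightarrow> A \<in> supertile_of ` parts n"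
proof (induction rule: producible.induct)
  case (init A)
  then show ?case unfolding target_init_def by auto
next
  case (combine A B G)
  then obtain \<alpha> \<beta> where "\<alpha> \<in> A" "\<beta> \<in> B" and *: "G = supertile_of (\<alpha> ++ \<beta>)"
    "dom \<alpha> \<inter> dom \<beta> = {}" "stable 1 (\<alpha> ++ \<beta>)" unfolding comb_def by blast
  then have "\<alpha> \<in> parts n" "\<beta> \<in> parts n"
    using combine.IH by (auto intro!: parts_subset_translate dest: supertile_of_eq)
  then obtain I a b where "\<alpha> ++ \<beta> = translate (rack n I) (a, b)" using parts_combine * by blast
  then show ?case using * by (metis image_eqI rack_in_parts(1))
next
  case (limit f)
  have step: "\<exists>I a b. f (Suc i) = translate (rack n I) (a, b)" if "f i \<in> parts n" for i
  proof -
    obtain \<beta> where \<beta>: "supertile_of \<beta> \<in> supertile_of ` parts n" "dom (f i) \<inter> dom \<beta> = {}"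
      "f (Suc i) = f i ++ \<beta>" "stable 1 (f (Suc i))" using limit.IH by blast
    then show ?thesis using parts_combine[OF that parts_subset_translate[OF \<beta>(1)]] by metis
  qed
  \<comment> \<open>\<open>f 0\<close> may be a plug to which a rack attaches, so the rack is
    tracked only from \<open>f (Suc 0)\<close> on.\<close>
  obtain I0 a b where 0: "f (Suc 0) = translate (rack n I0) (a, b)"
    using step[OF parts_subset_translate[OF limit.IH(1)]] by blast
  have ex: "\<exists>I. f (Suc i) = translate (rack n I) (a, b)" for i
  proof (induction i)
    case 0 then show ?case using \<open>f (Suc 0) = _\<close> by blast
  next
    case (Suc i)
    then obtain I where I: "f (Suc i) = translate (rack n I) (a, b)" by blast
    then have "f (Suc i) \<in> parts n" unfolding parts_def by blast
    moreover obtain \<beta> where \<beta>: "supertile_of \<beta> \<in> supertile_of ` parts n" "dom (f (Suc i)) \<inter> dom \<beta> = {}"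
      "f (Suc (Suc i)) = f (Suc i) ++ \<beta>" "stable 1 (f (Suc (Suc i)))" using limit.IH by blast
    ultimately obtain J k c d where J: "k \<notin> J" "f (Suc (Suc i)) = translate (rack n (insert k J)) (c, d)"
      "{f (Suc i), \<beta>} = {translate (rack n J) (c, d), translate (translate (plug (k mod n)) (2, row k)) (c, d)}"
      using parts_combine[OF _ parts_subset_translate[OF \<beta>(1)]] by metis
    \<comment> \<open>The spine fills a whole column, whereas a plug occupies a single row.\<close>
    have "f (Suc i) \<noteq> translate (translate (plug (k mod n)) (2, row k)) (c, d)"
    proof
      assume "f (Suc i) = translate (translate (plug (k mod n)) (2, row k)) (c, d)"
      then have "plug (k mod n) (a - c - 2, y - b - d - row k) = rack n I (0, y - 2 * b)" for y
        using fun_cong[OF I, of "(a, y - b)"] by (simp add: algebra_simps)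
      from this[of "b + d + row k + 1"] show False by (simp add: plug_def)
    qed
    then have eq: "translate (rack n J) (c, d) = translate (rack n I) (a, b)"
      using J(3) I by (metis doubleton_eq_iff)
    have *: "rack n J (x, y) = rack n I (x + (c - a), y + (d - b))" for x y
      using fun_cong[OF eq, of "(x + c, y + d)"] by (simp add: algebra_simps)
    have "c - a = 0 \<and> d - b = 0" by (rule rack_almost_shift[of "{}" n J I]) (use * in auto)
    then show ?case using J(2) by auto
  qed
  then obtain I where I: "\<And>i. f (Suc i) = translate (rack n (I i)) (a, b)" by metis
  let ?g = "translate (rack n (\<Union>i. I i)) (a, b)"
  have le: "f (Suc i) \<subseteq>\<^sub>m ?g" for i unfolding I by (intro translate_mono rack_mono) auto
  have "chain_limit f = ?g"
  proof (rule chain_limit_eq)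
    fix i
    obtain \<beta> where "dom (f 0) \<inter> dom \<beta> = {}" "f (Suc 0) = f 0 ++ \<beta>" using limit.IH(2)[of 0] by blast
    then have "f 0 \<subseteq>\<^sub>m f (Suc 0)" by (simp add: map_add_comm map_le_map_add)
    then show "f i \<subseteq>\<^sub>m ?g" using le map_le_trans by (cases i) blast+
  next
    fix p assume "?g p \<noteq> None"
    then show "\<exists>i. f i p \<noteq> None"
    proof (cases p)
      case (Pair x y)
      then obtain t where t: "rack n (\<Union>i. I i) (x - a, y - b) = Some t" using \<open>?g p \<noteq> None\<close> by auto
      have "\<exists>i. rack n (I i) (x - a, y - b) = Some t"
        using t unfolding rack_Some_iff by blast
      then show ?thesis using I Pair by (metis option.distinct(1) translate_apply)
    qed
  qed
  then show ?case unfolding parts_def by blast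
qed

lemma target_step_rack:
  assumes "k \<notin> I" "n > 0"
  shows "step (target_init n) 1 (supertile_of (rack n I)) (supertile_of (rack n (insert k I)))"
proof -
  let ?\<beta> = "translate (plug (k mod n)) (2, row k)"
  have plug: "supertile_of (plug (k mod n)) \<in> producible (target_init n) 1"
    using assms(2) by (intro producible.init) (auto simp: target_init_def)
  have "dom (rack n I) \<inter> dom ?\<beta> = {}"
    using assms(1) by (auto simp: rack_Some_iff plug_Some_iff split: if_splits)
  moreover have "rack n I ++ ?\<beta> = rack n (insert k I)" by (rule rack_add_plug[OF assms(1)])
  moreover have "?\<beta> \<in> supertile_of (plug (k mod n))" by (auto simp: in_supertile_of_iff)
  ultimately have "supertile_of (rack n (insert k I)) \<in> comb 1 (supertile_of (rack n I)) (supertile_of (plug (k mod n)))"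
    unfolding comb_def by (smt (verit) mem_Collect_eq self_in_supertile_of stable_rack)
  then show ?thesis unfolding step_def using plug by blast
qed

text \<open>With condition (ii) of a simulation, a partner of a simulated rack can have only two
  effects: none, or one more plug on a free hook.\<close>

lemma target_step_from_rack:
  assumes "step (target_init n) 1 (supertile_of (rack n I)) B"
  shows "\<exists>k. k \<notin> I \<and> B = supertile_of (rack n (insert k I))"
proof -
  obtain C \<alpha> \<beta> where C: "C \<in> producible (target_init n) 1" and \<alpha>: "\<alpha> \<in> supertile_of (rack n I)" and \<beta>: "\<beta> \<in> C"
    and *: "B = supertile_of (\<alpha> ++ \<beta>)" "dom \<alpha> \<inter> dom \<beta> = {}" "stable 1 (\<alpha> ++ \<beta>)"
    using assms unfolding step_def comb_def by blast
  obtain a0 b0 where ab: "\<alpha> = translate (rack n I) (a0, b0)" using \<alpha> in_supertile_of_iff by blast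
  have "\<beta> \<in> parts n"
    using target_producible_parts[OF C] \<beta> by (auto intro!: parts_subset_translate dest: supertile_of_eq)
  moreover have "\<alpha> \<in> parts n" using ab unfolding parts_def by blast
  ultimately obtain J k c d where J: "k \<notin> J" "\<alpha> ++ \<beta> = translate (rack n (insert k J)) (c, d)"
    "{\<alpha>, \<beta>} = {translate (rack n J) (c, d), translate (translate (plug (k mod n)) (2, row k)) (c, d)}"
    using parts_combine * by metis
  have "\<alpha> \<noteq> translate (translate (plug (k mod n)) (2, row k)) (c, d)"
  proof
    assume "\<alpha> = translate (translate (plug (k mod n)) (2, row k)) (c, d)"
    then have "plug (k mod n) (a0 - c - 2, y - d - row k) = rack n I (0, y - b0)" for y
      using fun_cong[OF ab, of "(a0, y)"] by (simp add: algebra_simps)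
    from this[of "d + row k + 1"] show False by (simp add: plug_def)
  qed
  then have "\<alpha> = translate (rack n J) (c, d)" using J(3) by (metis doubleton_eq_iff)
  then have "supertile_of (rack n J) = supertile_of (rack n I)" using ab by (metis supertile_of_translate)
  then have "J = I" by (rule rack_supertile_inject)
  then show ?thesis using J * by auto
qed

lemma target_init_over: "A \<in> target_init n \<Longrightarrow> n > 0 \<Longrightarrow> supertile_over (target_tiles n) A"
proof -
  assume A: "A \<in> target_init n" "n > 0"
  have 1: "rack n {} (x, y) = Some t \<Longrightarrow> t \<in> target_tiles n" for x y t
    using A(2) unfolding rack_Some_iff target_tiles_def by (auto split: if_splits)
  have 2: "j < n \<Longrightarrow> plug j p = Some t \<Longrightarrow> t \<in> target_tiles n" for j p t
    unfolding plug_Some_iff target_tiles_def by auto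
  have 3: "assembly_over (target_tiles n) (translate (rack n {}) v)" for v
    unfolding assembly_over_def ran_def translate_def using 1 by blast
  have 4: "j < n \<Longrightarrow> assembly_over (target_tiles n) (translate (plug j) v)" for j v
    unfolding assembly_over_def ran_def translate_def using 2 by blast
  show ?thesis using A(1) 3 4 unfolding target_init_def supertile_over_def is_supertile_def
    by (auto simp: in_supertile_of_iff)
qed

subsection \<open>Grids that pinch two neighbouring parts\<close>

lemma dvd_diff_eq: "(m::int) dvd x - y \<Longrightarrow> - m < x - y \<Longrightarrow> x - y < m \<Longrightarrow> x = y"
  by (metis abs_less_iff diff_eq_diff_eq diff_self dvd_imp_le_int linorder_not_le minus_less_iff
      abs_of_pos abs_ge_zero less_le_trans neg_less_0_iff_less not_less_iff_gr_or_eq)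

text \<open>\<open>cover\<close> provides a grid for each pair of residues but relates their origins
  in no way: the representation may place the same assembly differently in each translate.\<close>

locale pinch =
  fixes m :: int and Q :: "(int \<times> int) set"
  assumes m3: "m \<ge> 3"
    and cover: "\<And>u v. \<exists>a s. (a, s) \<in> Q \<and> m dvd a - u \<and> m dvd s - v"
begin

text \<open>\<open>Q\<close> holds the origins of grids in which an assembly is read. Columns are counted from the
  cell of a plug and rows from the row of its hook: in the grid with origin \<open>(a, s)\<close> the plug cell consists
  of the columns \<open>a \<le> X < a + m\<close>, the hook cell is west of it, and both consist of the rows
  \<open>s \<le> r < s + m\<close>. Clean mapping allows a tile of the rack in the plug cell but in no cell above or
  below it; likewise for a tile of the plug in the hook cell.\<close>
definition rack_ok :: "int \<Rightarrow> int \<Rightarrow> bool" where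
  "rack_ok X r \<longleftrightarrow> (\<forall>(a, s)\<in>Q. X < a + m \<and> (a \<le> X \<longrightarrow> s \<le> r \<and> r < s + m))"

definition plug_ok :: "int \<Rightarrow> int \<Rightarrow> bool" where
  "plug_ok X r \<longleftrightarrow> (\<forall>(a, s)\<in>Q. a - m \<le> X \<and> (X < a \<longrightarrow> s \<le> r \<and> r < s + m))"

definition common :: "int \<Rightarrow> bool" where
  "common c \<longleftrightarrow> (\<forall>(a, s)\<in>Q. s \<le> c \<and> c < s + m)"

lemma rack_okD: "rack_ok X r \<Longrightarrow> (a, s) \<in> Q \<Longrightarrow> X < a + m \<and> (a \<le> X \<longrightarrow> s \<le> r \<and> r < s + m)"
  by (auto simp: rack_ok_def)

lemma plug_okD: "plug_ok X r \<Longrightarrow> (a, s) \<in> Q \<Longrightarrow> a - m \<le> X \<and> (X < a \<longrightarrow> s \<le> r \<and> r < s + m)"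
  by (auto simp: plug_ok_def)

lemma commonD: "common c \<Longrightarrow> (a, s) \<in> Q \<Longrightarrow> s \<le> c \<and> c < s + m"
  by (auto simp: common_def)

text \<open>All bands contain \<open>c\<close> and they begin at every residue, so one of them has
  \<open>c\<close> as its last row. The column residue remains free, which is what the contact
  lemmas exploit.\<close>

lemma band_bottom:
  assumes "common c"
  shows "\<exists>a. (a, c + 1 - m) \<in> Q \<and> m dvd a - u"
proof -
  obtain a s where as: "(a, s) \<in> Q" "m dvd a - u" "m dvd s - (c + 1 - m)" using cover by blast
  have "s = c + 1 - m" by (rule dvd_diff_eq[OF as(3)]) (use commonD[OF assms as(1)] m3 in linarith)+
  then show ?thesis using as by blast
qed

lemma band_top:
  assumes "common c"
  shows "\<exists>a. (a, c) \<in> Q \<and> m dvd a - u"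
proof -
  obtain a s where as: "(a, s) \<in> Q" "m dvd a - u" "m dvd s - c" using cover by blast
  have "s = c" by (rule dvd_diff_eq[OF as(3)]) (use commonD[OF assms as(1)] m3 in linarith)+
  then show ?thesis using as by blast
qed

text \<open>The band that ends at one common row contains the other, so neither exceeds the
  other.\<close>

lemma common_unique: "common c \<Longrightarrow> common c' \<Longrightarrow> c = c'"
proof -
  have "c' \<le> c" if "common c" "common c'" for c c'
    using band_bottom[OF that(1)] commonD[OF that(2)] by force
  then show "common c \<Longrightarrow> common c' \<Longrightarrow> c = c'" by (simp add: order_antisym)
qed

text \<open>No grid line has the rack tile strictly west of it and the plug tile at or east of it,
  so in every grid at least one of the two tiles is confined to the band.\<close>

lemma rack_plug_ok_common: "rack_ok X r \<Longrightarrow> plug_ok X' r \<Longrightarrow> X' \<le> X \<Longrightarrow> common r"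
  unfolding rack_ok_def plug_ok_def common_def by fastforce

text \<open>A grid whose column origin is congruent to \<open>X\<close> has no line between
  \<open>X\<close> and \<open>X + 1\<close>, so one of the two tiles is confined to its band. The
  bands ending and starting at \<open>c\<close> share only the row \<open>c\<close>.\<close>

lemma east_row:
  assumes "common c" "rack_ok X r" "plug_ok (X + 1) r"
  shows "r = c"
proof -
  have ne: "a \<noteq> X + 1" if "m dvd a - X" for a
    using that m3 zdvd_imp_le[of m 1] by auto
  obtain a where a: "(a, c + 1 - m) \<in> Q" "m dvd a - X" using band_bottom[OF assms(1)] by blast
  obtain a' where a': "(a', c) \<in> Q" "m dvd a' - X" using band_top[OF assms(1)] by blast
  show ?thesis
    using ne[OF a(2)] ne[OF a'(2)] rack_okD[OF assms(2) a(1)] rack_okD[OF assms(2) a'(1)]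
      plug_okD[OF assms(3) a(1)] plug_okD[OF assms(3) a'(1)] by linarith
qed

text \<open>One of the bands ending or starting at \<open>c\<close> leaves out one of the two tiles.
  That tile stays on its own side of the grid line, so the other one has crossed it; the column
  residue is chosen so that it has crossed as far as its kind ever can.\<close>

lemma north_contact:
  assumes c: "common c" and al: "rack_ok X r" and ga: "plug_ok X (r + 1)"
  shows "(r = c \<and> (\<forall>X' r'. rack_ok X' r' \<longrightarrow> X' \<le> X)) \<or> (r + 1 = c \<and> (\<forall>X' r'. plug_ok X' r' \<longrightarrow> X \<le> X'))"
proof (cases "r \<ge> c")
  case True
  obtain a where a: "(a, c + 1 - m) \<in> Q" "m dvd a - (X + 1 - m)" using band_bottom[OF c] by blast
  have aX: "a \<le> X" "X < a + m" "r = c" using True rack_okD[OF al a(1)] plug_okD[OF ga a(1)] by linarith+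
  have "a = X + 1 - m" by (rule dvd_diff_eq[OF a(2)]) (use aX m3 in linarith)+
  then show ?thesis using aX(3) rack_okD[OF _ a(1)] by fastforce
next
  case False
  obtain a where a: "(a, c) \<in> Q" "m dvd a - (X + m)" using band_top[OF c] by blast
  have aX: "X < a" "a \<le> X + m" "r + 1 = c" using False rack_okD[OF al a(1)] plug_okD[OF ga a(1)] by linarith+
  have "a = X + m" by (rule dvd_diff_eq[OF a(2)]) (use aX m3 in linarith)+
  then show ?thesis using aX(3) plug_okD[OF _ a(1)] by fastforce
qed

lemma south_contact:
  assumes c: "common c" and al: "rack_ok X r" and ga: "plug_ok X (r - 1)"
  shows "(r = c \<and> (\<forall>X' r'. rack_ok X' r' \<longrightarrow> X' \<le> X)) \<or> (r - 1 = c \<and> (\<forall>X' r'. plug_ok X' r' \<longrightarrow> X \<le> X'))"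
proof (cases "r \<le> c")
  case True
  obtain a where a: "(a, c) \<in> Q" "m dvd a - (X + 1 - m)" using band_top[OF c] by blast
  have aX: "a \<le> X" "X < a + m" "r = c" using True rack_okD[OF al a(1)] plug_okD[OF ga a(1)] by linarith+
  have "a = X + 1 - m" by (rule dvd_diff_eq[OF a(2)]) (use aX m3 in linarith)+
  then show ?thesis using aX(3) rack_okD[OF _ a(1)] by fastforce
next
  case False
  obtain a where a: "(a, c + 1 - m) \<in> Q" "m dvd a - (X + m)" using band_bottom[OF c] by blast
  have aX: "X < a" "a \<le> X + m" "r - 1 = c" using False rack_okD[OF al a(1)] plug_okD[OF ga a(1)] by linarith+
  have "a = X + m" by (rule dvd_diff_eq[OF a(2)]) (use aX m3 in linarith)+
  then show ?thesis using aX(3) plug_okD[OF _ a(1)] by fastforce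
qed

text \<open>Plug tiles reach at most one cell west of the line and rack tiles at most one cell east
  of it, so a grid with the column residue of \<open>X\<close> has its line exactly at
  \<open>X\<close>. The rack tile is then in the plug cell both for the band ending at
  \<open>c\<close> and for the band starting there.\<close>

lemma beyond_row:
  assumes c: "common c" and g: "plug_ok g c" and al: "rack_ok X r" and "g < X"
  shows "r = c"
proof -
  have eq: "a = X" if "(a, s) \<in> Q" "m dvd a - X" for a s
    by (rule dvd_diff_eq[OF that(2)]) (use plug_okD[OF g that(1)] rack_okD[OF al that(1)] assms(4) in linarith)+
  obtain a where a: "(a, c + 1 - m) \<in> Q" "m dvd a - X" using band_bottom[OF c] by blast
  obtain a' where a': "(a', c) \<in> Q" "m dvd a' - X" using band_top[OF c] by blast
  show ?thesis using eq[OF a] eq[OF a'] rack_okD[OF al a(1)] rack_okD[OF al a'(1)] by linarith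
qed

text \<open>Grids of a column residue that separates neither contact confine both rows to all their
  bands, and these share at most one row. If the columns differed, each grid line would separate at
  most one contact, so the row would be common.\<close>

lemma east_unique:
  assumes nc: "\<And>c. \<not> common c"
    and 1: "rack_ok X1 r1" "plug_ok (X1 + 1) r1" and 2: "rack_ok X2 r2" "plug_ok (X2 + 1) r2"
  shows "X1 = X2 \<and> r1 = r2"
proof -
  have nd: "\<not> m dvd 1" "\<not> m dvd 2" using m3 zdvd_imp_le[of m 1] zdvd_imp_le[of m 2] by auto
  \<comment> \<open>Two residues are forbidden; as \<open>m\<close> is at least 3,
    \<open>X1 + 2\<close> or \<open>X1 + 3\<close> avoids both.\<close>
  obtain u where u: "\<not> m dvd u - (X1 + 1)" "\<not> m dvd u - (X2 + 1)"
  proof (cases "m dvd (X1 + 2) - (X2 + 1)")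
    case True
    have "\<not> m dvd (X1 + 3) - (X2 + 1)"
    proof
      assume "m dvd (X1 + 3) - (X2 + 1)"
      from dvd_diff[OF this True] show False using nd by simp
    qed
    then show thesis using that[of "X1 + 3"] nd by simp
  next
    case False then show thesis using that[of "X1 + 2"] nd by simp
  qed
  have band: "s \<le> r1 \<and> r1 < s + m \<and> s \<le> r2 \<and> r2 < s + m" if "(a, s) \<in> Q" "m dvd a - u" for a s
  proof -
    have "a \<noteq> X1 + 1" "a \<noteq> X2 + 1" using u that(2) by (metis dvd_minus_iff minus_diff_eq)+
    then show ?thesis using rack_okD[OF 1(1) that(1)] plug_okD[OF 1(2) that(1)] rack_okD[OF 2(1) that(1)] plug_okD[OF 2(2) that(1)]
      by linarith
  qed
  have le: "r' \<le> r" if "\<And>a s. (a, s) \<in> Q \<Longrightarrow> m dvd a - u \<Longrightarrow> s \<le> r \<and> r < s + m \<and> s \<le> r' \<and> r' < s + m" for r r'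
  proof -
    obtain a s where as: "(a, s) \<in> Q" "m dvd a - u" "m dvd s - (r + 1 - m)" using cover by blast
    have "s = r + 1 - m" by (rule dvd_diff_eq[OF as(3)]) (use that[OF as(1,2)] m3 in linarith)+
    then show ?thesis using that[OF as(1,2)] by linarith
  qed
  have r: "r1 = r2" using le[of r1 r2] le[of r2 r1] band by force
  have "X1 = X2"
  proof (rule ccontr)
    assume ne: "X1 \<noteq> X2"
    have "common r1" unfolding common_def
    proof (clarify)
      fix a s assume q: "(a, s) \<in> Q"
      show "s \<le> r1 \<and> r1 < s + m"
        using ne rack_okD[OF 1(1) q] plug_okD[OF 1(2) q] rack_okD[OF 2(1) q] plug_okD[OF 2(2) q] unfolding r by linarith
    qed
    then show False using nc by blast
  qed
  with r show ?thesis by simp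
qed

text \<open>Different rows would yield a common row in their range. Equal rows in different columns
  would put both \<open>r1\<close> and \<open>r1 + 1\<close> into a band that starts at
  \<open>r1 + 1\<close>.\<close>

lemma north_unique:
  assumes nc: "\<And>c. \<not> common c"
    and 1: "rack_ok X1 r1" "plug_ok X1 (r1 + 1)" and 2: "rack_ok X2 r2" "plug_ok X2 (r2 + 1)"
  shows "X1 = X2 \<and> r1 = r2"
proof -
  have *: "X1 = X2 \<and> r1 = r2" if 1: "rack_ok X1 r1" "plug_ok X1 (r1 + 1)" and 2: "rack_ok X2 r2" "plug_ok X2 (r2 + 1)"
    and le: "X1 \<le> X2" for X1 X2 r1 r2
  proof -
    note D = rack_okD[OF 1(1)] plug_okD[OF 1(2)] rack_okD[OF 2(1)] plug_okD[OF 2(2)]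
    have "\<not> r2 > r1"
    proof
      assume "r2 > r1"
      then have "common (r1 + 1)" unfolding common_def using D le by (smt (verit) case_prodI2)
      then show False using nc by blast
    qed
    moreover have "\<not> r2 < r1"
    proof
      assume "r2 < r1"
      then have "common r1" unfolding common_def using D le by (smt (verit) case_prodI2)
      then show False using nc by blast
    qed
    ultimately have r: "r1 = r2" by simp
    have "X1 = X2"
    proof (rule ccontr)
      assume "X1 \<noteq> X2"
      then have lt: "X1 < X2" using le by simp
      obtain a s where as: "(a, s) \<in> Q" "m dvd a - X2" "m dvd s - (r1 + 1)" using cover by blast
      have a: "a = X2" by (rule dvd_diff_eq[OF as(2)]) (use D[OF as(1)] lt in linarith)+
      have s: "s \<le> r1" "r1 + 1 < s + m" using D[OF as(1)] a lt r by linarith+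
      have "s = r1 + 1" by (rule dvd_diff_eq[OF as(3)]) (use s m3 in linarith)+
      then show False using s by simp
    qed
    with r show ?thesis by simp
  qed
  show ?thesis using *[OF 1 2] *[OF 2 1] by linarith
qed

lemma south_unique:
  assumes nc: "\<And>c. \<not> common c"
    and 1: "rack_ok X1 r1" "plug_ok X1 (r1 - 1)" and 2: "rack_ok X2 r2" "plug_ok X2 (r2 - 1)"
  shows "X1 = X2 \<and> r1 = r2"
proof -
  have *: "X1 = X2 \<and> r1 = r2" if 1: "rack_ok X1 r1" "plug_ok X1 (r1 - 1)" and 2: "rack_ok X2 r2" "plug_ok X2 (r2 - 1)"
    and le: "X1 \<le> X2" for X1 X2 r1 r2
  proof -
    note D = rack_okD[OF 1(1)] plug_okD[OF 1(2)] rack_okD[OF 2(1)] plug_okD[OF 2(2)]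
    have "\<not> r2 < r1"
    proof
      assume "r2 < r1"
      then have "common (r1 - 1)" unfolding common_def using D le by (smt (verit) case_prodI2)
      then show False using nc by blast
    qed
    moreover have "\<not> r2 > r1"
    proof
      assume "r2 > r1"
      then have "common r1" unfolding common_def using D le by (smt (verit) case_prodI2)
      then show False using nc by blast
    qed
    ultimately have r: "r1 = r2" by simp
    have "X1 = X2"
    proof (rule ccontr)
      assume "X1 \<noteq> X2"
      then have lt: "X1 < X2" using le by simp
      obtain a s where as: "(a, s) \<in> Q" "m dvd a - X2" "m dvd s - r1" using cover by blast
      have a: "a = X2" by (rule dvd_diff_eq[OF as(2)]) (use D[OF as(1)] lt in linarith)+
      have s: "s \<le> r1 - 1" "r1 < s + m" using D[OF as(1)] a lt r by linarith+
      have "s = r1" by (rule dvd_diff_eq[OF as(3)]) (use s m3 in linarith)+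
      then show False using s by simp
    qed
    with r show ?thesis by simp
  qed
  show ?thesis using *[OF 1 2] *[OF 2 1] by linarith
qed

end

subsection \<open>Reading the simulator in shifted grids\<close>

text \<open>\<open>n\<close> exceeds by one the number of ways to fill four cells, each empty or
  with a tile of \<open>U\<close>.\<close>

locale simulation =
  fixes U :: "tile set" and SU :: "supertile set" and \<tau>' m n :: nat and R :: "block \<Rightarrow> tile option"
  assumes finite_U: "finite U" and \<tau>'_pos: "\<tau>' \<ge> 1" and m_pos: "m \<ge> 1"
    and SU_over: "\<forall>A\<in>SU. supertile_over U A"
    and sim: "simulates SU \<tau>' (target_tiles n) (target_init n) 1 m R"
    and n_eq: "n = (card U + 1) ^ 4 + 1"
begin

abbreviation M :: int where "M \<equiv> int m"
abbreviation prodU :: "assembly \<Rightarrow> bool" where "prodU \<alpha> \<equiv> supertile_of \<alpha> \<in> producible SU \<tau>'"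
abbreviation rep :: "assembly \<Rightarrow> assembly" where "rep \<equiv> rep_star m R"
abbreviation empty_block :: block where "empty_block \<equiv> (\<lambda>_. None)"
definition near :: "assembly \<Rightarrow> int \<Rightarrow> int \<Rightarrow> bool" where
  "near \<beta> x y \<longleftrightarrow> (x, y) \<in> dom \<beta> \<or> (x + 1, y) \<in> dom \<beta> \<or> (x - 1, y) \<in> dom \<beta> \<or>
     (x, y + 1) \<in> dom \<beta> \<or> (x, y - 1) \<in> dom \<beta>"

lemma maps_cleanly_asm_near:
  "maps_cleanly_asm m R \<alpha> \<longleftrightarrow> (\<forall>a\<in>nonempty_blocks m \<alpha>. \<forall>b\<in>nonempty_blocks m \<alpha>. a = b) \<or>
     (\<forall>x y. (x, y) \<in> nonempty_blocks m \<alpha> \<longrightarrow> near (rep \<alpha>) x y)"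
  unfolding maps_cleanly_asm_def near_def by (simp add: Ball_def split_paired_All)

definition win :: "assembly \<Rightarrow> int \<Rightarrow> int \<Rightarrow> block" where
  "win \<alpha> x y = (\<lambda>(i, j). if i < m \<and> j < m then \<alpha> (x + int i, y + int j) else None)"

lemma M_pos: "M > 0" using m_pos by simp
lemma M_mono: "a \<le> b \<Longrightarrow> M * a \<le> M * b" by (simp add: mult_left_mono)
lemma n_pos: "n > 0" using n_eq by simp

lemma producible_supertile: "A \<in> producible SU \<tau>' \<Longrightarrow> \<exists>\<alpha>. A = supertile_of \<alpha>"
proof (induction rule: producible.cases)
  case (init A) then show ?case using SU_over by (auto simp: supertile_over_def is_supertile_def)
qed (auto simp: comb_def)

lemma assembly_over_translate: "assembly_over U (translate \<alpha> v) \<longleftrightarrow> assembly_over U \<alpha>"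
proof -
  have "ran (translate \<alpha> (a, b)) = ran \<alpha>" for a b
  proof -
    have "\<exists>p. translate \<alpha> (a, b) p = Some t" if "\<alpha> (x, y) = Some t" for x y t
      using that by (intro exI[of _ "(x + a, y + b)"]) simp
    moreover have "\<exists>p. \<alpha> p = Some t" if "translate \<alpha> (a, b) (x, y) = Some t" for x y t
      using that by auto
    ultimately show ?thesis unfolding ran_def by fast
  qed
  then show ?thesis unfolding assembly_over_def by (cases v) simp
qed

lemma assembly_over_add: "assembly_over U \<alpha> \<Longrightarrow> assembly_over U \<beta> \<Longrightarrow> assembly_over U (\<alpha> ++ \<beta>)"
  unfolding assembly_over_def ran_def subset_iff mem_Collect_eq by (metis map_add_Some_iff)

lemma producible_over: "A \<in> producible SU \<tau>' \<Longrightarrow> \<forall>\<alpha>\<in>A. assembly_over U \<alpha>"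
proof (induction rule: producible.induct)
  case (init A) then show ?case using SU_over by (auto simp: supertile_over_def)
next
  case (combine A B G)
  then obtain \<alpha> \<beta> where *: "\<alpha> \<in> A" "\<beta> \<in> B" "G = supertile_of (\<alpha> ++ \<beta>)" unfolding comb_def by blast
  have "assembly_over U (\<alpha> ++ \<beta>)"
    using combine.IH * by (intro assembly_over_add) auto
  then show ?case using * by (auto simp: in_supertile_of_iff assembly_over_translate)
next
  case (limit f)
  have over: "assembly_over U (f i)" for i
  proof (induction i)
    case 0 then show ?case using limit.IH(1) by auto
  next
    case (Suc i)
    obtain \<beta> where "\<forall>\<alpha>\<in>supertile_of \<beta>. assembly_over U \<alpha>" "f (Suc i) = f i ++ \<beta>"
      using limit.IH(2)[of i] by blast
    then show ?case using Suc self_in_supertile_of[of \<beta>] by (auto intro: assembly_over_add)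
  qed
  have "assembly_over U (chain_limit f)"
    unfolding assembly_over_def chain_limit_def
    using over unfolding assembly_over_def by (auto simp: ran_def split: if_splits)
  then show ?case by (auto simp: in_supertile_of_iff assembly_over_translate)
qed

lemma prodU_tile: "prodU \<alpha> \<Longrightarrow> \<alpha> p = Some t \<Longrightarrow> t \<in> U"
  using producible_over[of "supertile_of \<alpha>"] self_in_supertile_of[of \<alpha>]
  unfolding assembly_over_def by (meson ranI subsetD)

lemma block_translate: "block m (translate \<alpha> (- a, - b)) x y = win \<alpha> (a + M * x) (b + M * y)"
  by (auto simp: block_def win_def fun_eq_iff algebra_simps)

lemma rep_translate: "rep (translate \<alpha> (- a, - b)) (x, y) = R (win \<alpha> (a + M * x) (b + M * y))"
  by (simp add: rep_star_def block_translate)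

lemma rep_super_supertile:
  assumes "prodU \<alpha>"
  shows "rep_super m R (supertile_of \<alpha>) = supertile_of (rep \<alpha>)"
    and "supertile_of (rep \<alpha>) \<in> producible (target_init n) 1"
proof -
  have "maps_cleanly (target_tiles n) m R (supertile_of \<alpha>)" using sim assms by (simp add: simulates_def)
  then obtain \<beta> where \<beta>: "rep_super m R (supertile_of \<alpha>) = supertile_of \<beta>"
    by (auto simp: maps_cleanly_def supertile_over_def is_supertile_def)
  have "rep \<alpha> \<in> rep_super m R (supertile_of \<alpha>)" by (simp add: rep_super_def)
  then show 1: "rep_super m R (supertile_of \<alpha>) = supertile_of (rep \<alpha>)" using \<beta> supertile_of_eq by metis
  have "rep_super m R (supertile_of \<alpha>) \<in> producible (target_init n) 1"
    using sim assms unfolding simulates_def by blast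
  then show "supertile_of (rep \<alpha>) \<in> producible (target_init n) 1" using 1 by simp
qed

lemma prodU_clean: "prodU \<alpha> \<Longrightarrow> maps_cleanly_asm m R (translate \<alpha> (a, b))"
proof -
  assume "prodU \<alpha>"
  then have "maps_cleanly (target_tiles n) m R (supertile_of \<alpha>)" using sim by (simp add: simulates_def)
  moreover have "translate \<alpha> (a, b) \<in> supertile_of \<alpha>" by (auto simp: in_supertile_of_iff)
  ultimately show ?thesis by (simp add: maps_cleanly_def)
qed

lemma prodU_rep: "prodU \<alpha> \<Longrightarrow> supertile_of (rep \<alpha>) = supertile_of \<beta> \<Longrightarrow>
  \<exists>z w. rep (translate \<alpha> (a, b)) = translate \<beta> (z, w)"
proof -
  assume *: "prodU \<alpha>" "supertile_of (rep \<alpha>) = supertile_of \<beta>"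
  have "rep (translate \<alpha> (a, b)) \<in> rep_super m R (supertile_of \<alpha>)"
    unfolding rep_super_def using in_supertile_of_iff by blast
  then show ?thesis using * rep_super_supertile(1) in_supertile_of_iff by metis
qed

lemma prodU_exists:
  assumes "supertile_of \<beta> \<in> producible (target_init n) 1"
  shows "\<exists>\<alpha>. prodU \<alpha> \<and> supertile_of (rep \<alpha>) = supertile_of \<beta>"
proof -
  obtain A where A: "A \<in> producible SU \<tau>'" "rep_super m R A = supertile_of \<beta>"
    using sim assms unfolding simulates_def by (metis (no_types, lifting) imageE)
  then show ?thesis using producible_supertile rep_super_supertile(1) by metis
qed

text \<open>If the empty block represented a tile, every block representing none would be nonempty,
  even far from a represented plug, where clean mapping forbids it.\<close>

lemma R_empty: "R empty_block = None"
proof (rule ccontr)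
  assume e: "R empty_block \<noteq> None"
  have "supertile_of (plug 0) \<in> producible (target_init n) 1"
    using n_pos by (intro producible.init) (auto simp: target_init_def)
  then obtain \<gamma> where \<gamma>: "prodU \<gamma>" "supertile_of (rep \<gamma>) = supertile_of (plug 0)" using prodU_exists by blast
  obtain z w where r: "rep (translate \<gamma> (0, 0)) = translate (plug 0) (z, w)" using prodU_rep[OF \<gamma>] by blast
  have ne: "(z + i, w + j) \<in> nonempty_blocks m \<gamma>" if "j \<noteq> 0" for i j
  proof -
    have "R (block m \<gamma> (z + i) (w + j)) = None"
      using fun_cong[OF r, of "(z + i, w + j)"] that by (simp add: rep_star_def plug_def)
    then show ?thesis using e by (auto simp: nonempty_blocks_def)
  qed
  have "maps_cleanly_asm m R \<gamma>" using prodU_clean[OF \<gamma>(1), of 0 0] by simp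
  moreover have "(z + 5, w + 5) \<in> nonempty_blocks m \<gamma>" "(z + 6, w + 5) \<in> nonempty_blocks m \<gamma>"
    using ne[of 5 5] ne[of 5 6] by auto
  ultimately have "near (rep \<gamma>) (z + 5) (w + 5)"
    unfolding maps_cleanly_asm_near by fastforce
  then show False using r unfolding near_def by (simp add: dom_def plug_def split: if_splits)
qed

text \<open>The blocks of \<open>\<alpha>\<close> in the grid through \<open>(u, v)\<close> represent \<open>\<beta>\<close> cleanly. The grid need not be the
  standard one: all translates of a producible assembly have to be represented correctly.\<close>
definition reads :: "assembly \<Rightarrow> assembly \<Rightarrow> int \<Rightarrow> int \<Rightarrow> bool" where
  "reads \<beta> \<alpha> u v \<longleftrightarrow> (\<forall>x y. R (win \<alpha> (u + M * x) (v + M * y)) = \<beta> (x, y)) \<and>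
     (\<forall>x y. win \<alpha> (u + M * x) (v + M * y) \<noteq> empty_block \<longrightarrow>
        near \<beta> x y)"

text \<open>Two represented tiles exclude the exception that clean mapping makes for a single
  nonempty block. The residues of the grid are prescribed by \<open>a\<close> and \<open>b\<close>;
  the cell offsets \<open>z\<close> and \<open>w\<close> are up to the representation.\<close>

lemma reads_exists:
  assumes \<alpha>: "prodU \<alpha>" "supertile_of (rep \<alpha>) = supertile_of \<beta>"
    and two: "p \<in> dom \<beta>" "q \<in> dom \<beta>" "p \<noteq> q"
  shows "\<exists>z w. reads \<beta> \<alpha> (a + M * z) (b + M * w)"
proof -
  let ?\<alpha> = "translate \<alpha> (- a, - b)"
  obtain z w where r: "rep ?\<alpha> = translate \<beta> (z, w)" using prodU_rep[OF \<alpha>] by blast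
  have val: "R (win \<alpha> (a + M * (x + z)) (b + M * (y + w))) = \<beta> (x, y)" for x y
    using fun_cong[OF r, of "(x + z, y + w)"] by (simp add: rep_translate)
  have bl: "(x, y) \<in> nonempty_blocks m ?\<alpha> \<longleftrightarrow> win \<alpha> (a + M * x) (b + M * y) \<noteq> empty_block" for x y
    by (simp add: nonempty_blocks_def block_translate)
  have nb: "(x + z, y + w) \<in> nonempty_blocks m ?\<alpha>" if "(x, y) \<in> dom \<beta>" for x y
    using val[of x y] that R_empty unfolding bl by force
  obtain x1 y1 x2 y2 where xy: "p = (x1, y1)" "q = (x2, y2)" by fastforce
  have "\<not> (\<forall>p\<in>nonempty_blocks m ?\<alpha>. \<forall>q\<in>nonempty_blocks m ?\<alpha>. p = q)"
    using nb[of x1 y1] nb[of x2 y2] two unfolding xy by (metis Pair_inject add_right_cancel)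
  then have cl: "near (rep ?\<alpha>) x y" if "(x, y) \<in> nonempty_blocks m ?\<alpha>" for x y
    using prodU_clean[OF \<alpha>(1), of "- a" "- b"] that unfolding maps_cleanly_asm_near by blast
  have "near \<beta> x y" if "win \<alpha> (a + M * (x + z)) (b + M * (y + w)) \<noteq> empty_block" for x y
  proof -
    have "near (rep ?\<alpha>) (x + z) (y + w)" using that bl cl by blast
    then show ?thesis unfolding r near_def domIff by (simp add: algebra_simps)
  qed
  then have "reads \<beta> \<alpha> (a + M * z) (b + M * w)"
    using val unfolding reads_def by (simp add: algebra_simps)
  then show ?thesis by blast
qed

lemma win_nonempty:
  assumes "(x, y) \<in> dom \<alpha>" "a \<le> x" "x < a + M" "b \<le> y" "y < b + M"
  shows "win \<alpha> a b \<noteq> empty_block"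
proof
  assume "win \<alpha> a b = empty_block"
  from fun_cong[OF this, of "(nat (x - a), nat (y - b))"] show False
    using assms by (auto simp: win_def split: if_splits)
qed

lemma reads_cell:
  assumes "reads \<beta> \<alpha> u v" "(x, y) \<in> dom \<alpha>"
  shows "\<exists>X Y. u + M * X \<le> x \<and> x < u + M * X + M \<and> v + M * Y \<le> y \<and> y < v + M * Y + M \<and>
    near \<beta> X Y"
proof -
  have *: "u + M * ((x - u) div M) \<le> x \<and> x < u + M * ((x - u) div M) + M" for u x
  proof -
    have "M * ((x - u) div M) + (x - u) mod M = x - u" "0 \<le> (x - u) mod M" "(x - u) mod M < M"
      using M_pos by (auto simp: mult_div_mod_eq)
    then show ?thesis by linarith
  qed
  show ?thesis
    by (rule exI[of _ "(x - u) div M"], rule exI[of _ "(y - v) div M"])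
      (use * win_nonempty[OF assms(2)] assms(1) in \<open>unfold reads_def, blast\<close>)
qed

lemma reads_tile:
  assumes "reads \<beta> \<alpha> u v" "(X, Y) \<in> dom \<beta>"
  shows "\<exists>x y. (x, y) \<in> dom \<alpha> \<and> u + M * X \<le> x \<and> x < u + M * X + M \<and> v + M * Y \<le> y \<and> y < v + M * Y + M"
proof -
  have "R (win \<alpha> (u + M * X) (v + M * Y)) \<noteq> None" using assms unfolding reads_def by auto
  then have "win \<alpha> (u + M * X) (v + M * Y) \<noteq> empty_block" using R_empty by metis
  then obtain i j where "win \<alpha> (u + M * X) (v + M * Y) (i, j) \<noteq> None" by fastforce
  then have "i < m" "j < m" "(u + M * X + int i, v + M * Y + int j) \<in> dom \<alpha>"
    by (auto simp: win_def split: if_splits)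
  then show ?thesis by (intro exI[of _ "u + M * X + int i"] exI[of _ "v + M * Y + int j"]) auto
qed

section \<open>Simulator assemblies representing racks and plugs\<close>

definition rack_like :: "assembly \<Rightarrow> nat set \<Rightarrow> bool" where
  "rack_like \<alpha> I \<longleftrightarrow> prodU \<alpha> \<and> supertile_of (rep \<alpha>) = supertile_of (rack n I)"

definition plug_like :: "assembly \<Rightarrow> bool" where
  "plug_like \<gamma> \<longleftrightarrow> prodU \<gamma> \<and> (\<exists>j<n. supertile_of (rep \<gamma>) = supertile_of (plug j))"

lemma rack_like_or_plug_like: "prodU \<alpha> \<Longrightarrow> (\<exists>I. rack_like \<alpha> I) \<or> plug_like \<alpha>"
proof -
  assume \<alpha>: "prodU \<alpha>"
  then obtain \<beta> where "\<beta> \<in> parts n" "supertile_of (rep \<alpha>) = supertile_of \<beta>"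
    using target_producible_parts rep_super_supertile(2) by blast
  then show ?thesis using \<alpha> unfolding parts_def rack_like_def plug_like_def by auto
qed

lemma rack_like_reads: "rack_like \<alpha> I \<Longrightarrow> \<exists>z w. reads (rack n I) \<alpha> (a + M * z) (b + M * w)"
  unfolding rack_like_def using reads_exists[of \<alpha> "rack n I" "(0, 0)" "(0, 1)" a b] by (simp add: in_dom_rack_iff)

lemma plug_like_reads: "plug_like \<gamma> \<Longrightarrow> \<exists>j z w. j < n \<and> reads (plug j) \<gamma> (a + M * z) (b + M * w)"
proof -
  assume "plug_like \<gamma>"
  then obtain j where "j < n" "prodU \<gamma>" "supertile_of (rep \<gamma>) = supertile_of (plug j)" unfolding plug_like_def by blast
  then show ?thesis using reads_exists[of \<gamma> "plug j" "(0, 0)" "(1, 0)"] by (auto simp: dom_plug)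
qed

lemma plug_like_finite: "plug_like \<gamma> \<Longrightarrow> finite (dom \<gamma>)"
proof -
  assume "plug_like \<gamma>"
  then obtain j z w where r: "reads (plug j) \<gamma> (0 + M * z) (0 + M * w)" using plug_like_reads by blast
  have "dom \<gamma> \<subseteq> {M * z - M..<M * z + 3 * M} \<times> {M * w - M..<M * w + 2 * M}"
  proof (clarify)
    fix x y t assume "\<gamma> (x, y) = Some t"
    then have "(x, y) \<in> dom \<gamma>" by blast
    from reads_cell[OF r this] obtain X Y where X: "M * z + M * X \<le> x" "x < M * z + M * X + M"
      "M * w + M * Y \<le> y" "y < M * w + M * Y + M" and "near (plug j) X Y" by auto
    then have "- 1 \<le> X" "X \<le> 2" "- 1 \<le> Y" "Y \<le> 1" unfolding near_def dom_plug by auto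
    then have "M * (- 1) \<le> M * X" "M * X \<le> M * 2" "M * (- 1) \<le> M * Y" "M * Y \<le> M * 1"
      by - (rule M_mono, assumption)+
    then show "x \<in> {M * z - M..<M * z + 3 * M} \<and> y \<in> {M * w - M..<M * w + 2 * M}"
      unfolding atLeastLessThan_iff using X by linarith
  qed
  then show "finite (dom \<gamma>)" by (rule finite_subset) auto
qed

lemma rack_reads_width:
  assumes "reads (rack n I) \<alpha> u v" "(x, y) \<in> dom \<alpha>"
  shows "u - M \<le> x \<and> x < u + 5 * M"
proof -
  obtain X Y where X: "u + M * X \<le> x" "x < u + M * X + M" "near (rack n I) X Y"
    using reads_cell[OF assms] by blast
  then have "- 1 \<le> X" "X \<le> 4" unfolding near_def in_dom_rack_iff by auto
  then have "M * (- 1) \<le> M * X" "M * X \<le> M * 4"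
    by - (rule M_mono, assumption)+
  then show ?thesis using X(1,2) by linarith
qed

definition rows :: "assembly \<Rightarrow> int \<Rightarrow> int \<Rightarrow> pos set" where
  "rows \<alpha> s t = {(x, y) \<in> dom \<alpha>. s \<le> y \<and> y < t}"

text \<open>Clean mapping confines a simulated rack to the cell columns -1 to 4, hence the factor
  6.\<close>

lemma rows_bound:
  assumes "rack_like \<alpha> I"
  shows "finite (rows \<alpha> s t)" "card (rows \<alpha> s t) \<le> nat (6 * M) * nat (t - s)"
proof -
  obtain z w where r: "reads (rack n I) \<alpha> (0 + M * z) (0 + M * w)" using rack_like_reads[OF assms] by blast
  let ?B = "{M * z - M..<M * z + 5 * M} \<times> {s..<t}"
  have sub: "rows \<alpha> s t \<subseteq> ?B"
  proof (rule subrelI)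
    fix x y assume "(x, y) \<in> rows \<alpha> s t"
    then show "(x, y) \<in> ?B" using rack_reads_width[OF r, of x y] by (simp add: rows_def)
  qed
  have fin: "finite ?B" by simp
  show "finite (rows \<alpha> s t)" using sub fin by (rule finite_subset)
  have "card (rows \<alpha> s t) \<le> card ?B" using fin sub by (rule card_mono)
  also have "\<dots> = nat (6 * M) * nat (t - s)" by (simp add: card_cartesian_product algebra_simps)
  finally show "card (rows \<alpha> s t) \<le> nat (6 * M) * nat (t - s)" .
qed

lemma rows_mono: "\<alpha> \<subseteq>\<^sub>m \<beta> \<Longrightarrow> rows \<alpha> s t \<subseteq> rows \<beta> s t"
  by (auto simp: rows_def dest: map_le_implies_dom_le)

text \<open>Steps are relations between supertiles; fixing the positions of both assemblies makes it
  possible to follow individual tiles through a sequence of steps.\<close>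

definition attach :: "assembly \<Rightarrow> assembly \<Rightarrow> bool" where
  "attach \<alpha> \<gamma> \<longleftrightarrow> prodU \<gamma> \<and> dom \<alpha> \<inter> dom \<gamma> = {} \<and> stable \<tau>' (\<alpha> ++ \<gamma>)"

lemma attach_le: "attach \<alpha> \<gamma> \<Longrightarrow> \<alpha> \<subseteq>\<^sub>m \<alpha> ++ \<gamma>"
  unfolding attach_def using map_add_comm[of \<alpha> \<gamma>] map_le_map_add[of \<alpha> \<gamma>] by simp

lemma attach_comb: "attach \<alpha> \<gamma> \<Longrightarrow> supertile_of (\<alpha> ++ \<gamma>) \<in> comb \<tau>' (supertile_of \<alpha>) (supertile_of \<gamma>)"
  unfolding attach_def comb_def mem_Collect_eq
  by (intro exI[of _ \<alpha>] exI[of _ \<gamma>]) simp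

lemma attach_prodU: "prodU \<alpha> \<Longrightarrow> attach \<alpha> \<gamma> \<Longrightarrow> prodU (\<alpha> ++ \<gamma>)"
  by (rule producible.combine[OF _ _ attach_comb]) (simp_all add: attach_def)

lemma attach_rack_like:
  assumes "rack_like \<alpha> I" "attach \<alpha> \<gamma>"
  shows "\<exists>I'. rack_like (\<alpha> ++ \<gamma>) I' \<and> (I' = I \<or> (\<exists>k. k \<notin> I \<and> I' = insert k I))"
proof -
  have p: "prodU \<alpha>" "prodU (\<alpha> ++ \<gamma>)" "supertile_of (rep \<alpha>) = supertile_of (rack n I)"
    using assms attach_prodU unfolding rack_like_def by auto
  have "step SU \<tau>' (supertile_of \<alpha>) (supertile_of (\<alpha> ++ \<gamma>))"
    using attach_comb[OF assms(2)] assms(2) unfolding step_def attach_def by blast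
  then have "step_le1 (target_init n) 1 (rep_super m R (supertile_of \<alpha>)) (rep_super m R (supertile_of (\<alpha> ++ \<gamma>)))"
    using sim p(1,2) unfolding simulates_def by blast
  then have "step_le1 (target_init n) 1 (supertile_of (rack n I)) (supertile_of (rep (\<alpha> ++ \<gamma>)))"
    using rep_super_supertile(1) p by simp
  then show ?thesis using target_step_from_rack p(2) unfolding step_le1_def rack_like_def by metis
qed

lemma step_attach:
  assumes "step SU \<tau>' (supertile_of \<alpha>) B"
  shows "\<exists>\<gamma>. attach \<alpha> \<gamma> \<and> B = supertile_of (\<alpha> ++ \<gamma>)"
proof -
  obtain C \<alpha>0 \<gamma>0 where C: "C \<in> producible SU \<tau>'" "\<alpha>0 \<in> supertile_of \<alpha>" "\<gamma>0 \<in> C"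
    "dom \<alpha>0 \<inter> dom \<gamma>0 = {}" "stable \<tau>' (\<alpha>0 ++ \<gamma>0)" "B = supertile_of (\<alpha>0 ++ \<gamma>0)"
    using assms unfolding step_def comb_def by blast
  obtain a b where ab: "\<alpha>0 = translate \<alpha> (a, b)" using C(2) in_supertile_of_iff by blast
  let ?\<gamma> = "translate \<gamma>0 (- a, - b)"
  have al: "\<alpha> = translate \<alpha>0 (- a, - b)" by (simp add: ab translate_translate)
  have un: "\<alpha> ++ ?\<gamma> = translate (\<alpha>0 ++ \<gamma>0) (- a, - b)" by (simp add: al translate_add)
  have "C = supertile_of \<gamma>0" using C(1,3) producible_supertile supertile_of_eq by blast
  then have "prodU ?\<gamma>" using C(1) by simp
  moreover have "dom \<alpha> \<inter> dom ?\<gamma> = {}"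
  proof -
    have "\<alpha>0 p = None \<or> \<gamma>0 p = None" for p using C(4) by blast
    then have "translate \<alpha>0 v p = None \<or> translate \<gamma>0 v p = None" for v p by (simp add: translate_def)
    then show ?thesis unfolding al by (metis disjoint_iff domIff)
  qed
  moreover have "stable \<tau>' (\<alpha> ++ ?\<gamma>)" unfolding un using C(5) by (rule stable_translate)
  moreover have "B = supertile_of (\<alpha> ++ ?\<gamma>)" unfolding un C(6) by simp
  ultimately show ?thesis unfolding attach_def by blast
qed

lemma win_cong: "(\<And>x y. a \<le> x \<Longrightarrow> x < a + M \<Longrightarrow> b \<le> y \<Longrightarrow> y < b + M \<Longrightarrow> \<alpha> (x, y) = \<beta> (x, y)) \<Longrightarrow> win \<alpha> a b = win \<beta> a b"
  by (auto simp: win_def fun_eq_iff)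

text \<open>Outside the finitely many cells that meet \<open>\<gamma>\<close> both readings see the
  same blocks, so the represented racks agree there up to a shift, which must be 0.\<close>

lemma reads_aligned:
  assumes r: "reads (rack n I) \<alpha> u v" and fin: "finite (dom \<gamma>)" and rack_like: "rack_like (\<alpha> ++ \<gamma>) I'"
  shows "reads (rack n I') (\<alpha> ++ \<gamma>) u v"
proof -
  obtain z w where r': "reads (rack n I') (\<alpha> ++ \<gamma>) (u + M * z) (v + M * w)" using rack_like_reads[OF rack_like] by blast
  let ?f = "\<lambda>(x, y). ((x - u) div M - z, (y - v) div M - w)"
  have "z = 0 \<and> w = 0"
  proof (rule rack_almost_shift[of "?f ` dom \<gamma>" n I' I])
    show "finite (?f ` dom \<gamma>)" using fin by simp
    fix X Y assume XY: "(X, Y) \<notin> ?f ` dom \<gamma>"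
    have "win (\<alpha> ++ \<gamma>) (u + M * (X + z)) (v + M * (Y + w)) = win \<alpha> (u + M * (X + z)) (v + M * (Y + w))"
    proof (rule win_cong)
      fix x y assume h: "u + M * (X + z) \<le> x" "x < u + M * (X + z) + M" "v + M * (Y + w) \<le> y" "y < v + M * (Y + w) + M"
      have "(x - u) div M = X + z" using h(1,2) by (intro int_div_pos_eq[of _ _ _ "x - u - M * (X + z)"]) auto
      moreover have "(y - v) div M = Y + w" using h(3,4) by (intro int_div_pos_eq[of _ _ _ "y - v - M * (Y + w)"]) auto
      ultimately have "?f (x, y) = (X, Y)" by simp
      then have "(x, y) \<notin> dom \<gamma>" using XY image_eqI[of "(X, Y)" ?f "(x, y)" "dom \<gamma>"] by auto
      then show "(\<alpha> ++ \<gamma>) (x, y) = \<alpha> (x, y)" by (simp add: map_add_dom_app_simps(3))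
    qed
    moreover have "R (win \<alpha> (u + M * (X + z)) (v + M * (Y + w))) = rack n I (X + z, Y + w)"
      using r unfolding reads_def by blast
    moreover have "R (win (\<alpha> ++ \<gamma>) (u + M * z + M * X) (v + M * w + M * Y)) = rack n I' (X, Y)"
      using r' unfolding reads_def by blast
    moreover have "u + M * z + M * X = u + M * (X + z)" "v + M * w + M * Y = v + M * (Y + w)"
      by (simp_all add: algebra_simps)
    ultimately show "rack n I' (X, Y) = rack n I (X + z, Y + w)" by metis
  qed
  then show ?thesis using r' by simp
qed

subsection \<open>Saturated simulators\<close>

text \<open>Together with \<open>band_max s N\<close> this makes the band of \<open>M\<close> rows
  at \<open>s\<close> full. The grids in \<open>Q\<close> are fixed once and remain valid for all
  later assemblies.\<close>

definition good :: "(int \<times> int) set \<Rightarrow> int \<Rightarrow> nat \<Rightarrow> assembly \<Rightarrow> nat set \<Rightarrow> bool" where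
  "good Q s N \<alpha> I \<longleftrightarrow> rack_like \<alpha> I \<and> finite I \<and> N \<le> card (rows \<alpha> s (s + M)) \<and>
     (\<forall>(u, v)\<in>Q. reads (rack n I) \<alpha> u v)"

definition band_max :: "int \<Rightarrow> nat \<Rightarrow> bool" where
  "band_max s N \<longleftrightarrow> (\<forall>\<beta> J. rack_like \<beta> J \<longrightarrow> finite J \<longrightarrow> card (rows \<beta> s (s + M)) \<le> N)"

lemma exists_saturated:
  "\<exists>Q s N \<alpha> I. good Q s N \<alpha> I \<and> finite Q \<and> (\<forall>u v. \<exists>a b. (a, b) \<in> Q \<and> M dvd a - u \<and> M dvd b - v) \<and>
     band_max s N"
proof -
  define P where "P = (\<lambda>(\<alpha>, I). rack_like \<alpha> I \<and> finite I)"
  define f where "f = (\<lambda>(\<alpha>, I :: nat set). card (rows \<alpha> 0 (0 + M)))"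
  have "supertile_of (rack n {}) \<in> producible (target_init n) 1"
    by (intro producible.init) (simp add: target_init_def)
  then obtain \<alpha>0 where "P (\<alpha>0, {})" using prodU_exists unfolding P_def rack_like_def by auto
  moreover have "\<forall>x. P x \<longrightarrow> f x < nat (6 * M) * nat M + 1"
    using rows_bound(2)[of _ _ 0 "0 + M"] by (force simp: P_def f_def)
  ultimately obtain x where x: "P x" "\<forall>y. P y \<longrightarrow> f y \<le> f x"
    using ex_has_greatest_nat[of P "(\<alpha>0, {})" f "nat (6 * M) * nat M + 1"] by blast
  obtain \<alpha> I where xe: "x = (\<alpha>, I)" by fastforce
  have rack_like: "rack_like \<alpha> I" "finite I" using x(1) by (auto simp: P_def xe)
  have mx: "card (rows \<beta> 0 (0 + M)) \<le> card (rows \<alpha> 0 (0 + M))" if "rack_like \<beta> J" "finite J" for \<beta> J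
    using x(2) that by (auto simp: P_def f_def xe)
  obtain z w where zw: "\<And>a b. reads (rack n I) \<alpha> (a + M * z a b) (b + M * w a b)"
    using rack_like_reads[OF rack_like(1)] by metis
  define Q where "Q = (\<lambda>(a, b). (a + M * z a b, b + M * w a b)) ` ({0..<M} \<times> {0..<M})"
  have "\<exists>a b. (a, b) \<in> Q \<and> M dvd a - u \<and> M dvd b - v" for u v
  proof -
    let ?a = "u mod M" and ?b = "v mod M"
    have "(?a + M * z ?a ?b, ?b + M * w ?a ?b) \<in> Q"
      unfolding Q_def using M_pos by (intro image_eqI[of _ _ "(?a, ?b)"]) auto
    moreover have "M dvd ?a + M * z ?a ?b - u" "M dvd ?b + M * w ?a ?b - v"
      by (simp_all add: mod_eq_dvd_iff[symmetric] mod_simps)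
    ultimately show ?thesis by blast
  qed
  moreover have "finite Q" unfolding Q_def by simp
  moreover have "good Q 0 (card (rows \<alpha> 0 (0 + M))) \<alpha> I"
    unfolding good_def using rack_like zw by (auto simp: Q_def)
  moreover have "band_max 0 (card (rows \<alpha> 0 (0 + M)))" unfolding band_max_def using mx by blast
  ultimately show ?thesis by blast
qed

lemma attach_rows_card_less:
  assumes "attach \<alpha> \<gamma>" "rack_like (\<alpha> ++ \<gamma>) I" "rows \<gamma> s t \<noteq> {}"
  shows "card (rows \<alpha> s t) < card (rows (\<alpha> ++ \<gamma>) s t)"
proof (rule psubset_card_mono)
  show "finite (rows (\<alpha> ++ \<gamma>) s t)" using rows_bound(1)[OF assms(2)] .
  obtain p where p: "p \<in> rows \<gamma> s t" using assms(3) by blast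
  then have "p \<in> rows (\<alpha> ++ \<gamma>) s t" "p \<notin> rows \<alpha> s t"
    using assms(1) unfolding rows_def attach_def by auto
  then show "rows \<alpha> s t \<subset> rows (\<alpha> ++ \<gamma>) s t" using rows_mono[OF attach_le[OF assms(1)]] by blast
qed

lemma rack_like_rows_nonempty: "rack_like \<gamma> I \<Longrightarrow> rows \<gamma> s (s + M) \<noteq> {}"
proof -
  assume "rack_like \<gamma> I"
  then obtain z w where r: "reads (rack n I) \<gamma> (0 + M * z) (s + M * w)" using rack_like_reads by blast
  have "(0, - w) \<in> dom (rack n I)" by (simp add: in_dom_rack_iff)
  from reads_tile[OF r this] show ?thesis by (auto simp: rows_def)
qed

text \<open>A rack-like partner would add a tile to the full band. The partner is therefore
  plug-like, hence finite, and the grids of \<open>Q\<close> survive.\<close>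

lemma good_attach:
  assumes g: "good Q s N \<alpha> I" and att: "attach \<alpha> \<gamma>"
    and mx: "band_max s N"
  shows "plug_like \<gamma> \<and> (\<exists>I'. good Q s N (\<alpha> ++ \<gamma>) I' \<and> I \<subseteq> I')"
proof -
  obtain I' where I': "rack_like (\<alpha> ++ \<gamma>) I'" "I' = I \<or> (\<exists>k. k \<notin> I \<and> I' = insert k I)"
    using attach_rack_like[OF _ att] g unfolding good_def by blast
  have fin: "finite I'" using I'(2) g unfolding good_def by auto
  have "\<not> rack_like \<gamma> J" for J
  proof
    assume "rack_like \<gamma> J"
    then have "card (rows \<alpha> s (s + M)) < card (rows (\<alpha> ++ \<gamma>) s (s + M))"
      using attach_rows_card_less[OF att I'(1)] rack_like_rows_nonempty by blast
    then show False using mx I'(1) fin g unfolding good_def band_max_def by fastforce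
  qed
  then have plug_like: "plug_like \<gamma>" using rack_like_or_plug_like att unfolding attach_def by blast
  have "card (rows \<alpha> s (s + M)) \<le> card (rows (\<alpha> ++ \<gamma>) s (s + M))"
    by (rule card_mono[OF rows_bound(1)[OF I'(1)] rows_mono[OF attach_le[OF att]]])
  then have "good Q s N (\<alpha> ++ \<gamma>) I'"
    using g I'(1) fin reads_aligned[OF _ plug_like_finite[OF plug_like] I'(1)] unfolding good_def by fastforce
  then show ?thesis using plug_like I'(2) by blast
qed

lemma good_steps:
  assumes "steps SU \<tau>' (supertile_of \<alpha>) A" "good Q s N \<alpha> I"
    and mx: "band_max s N"
  shows "\<exists>\<beta> J. A = supertile_of \<beta> \<and> good Q s N \<beta> J \<and> \<alpha> \<subseteq>\<^sub>m \<beta> \<and> I \<subseteq> J"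
  using assms(1)
proof (induction rule: rtranclp_induct)
  case base
  show ?case using assms(2) map_le_refl[of \<alpha>] by blast
next
  case (step A B)
  then obtain \<beta> J where b: "A = supertile_of \<beta>" "good Q s N \<beta> J" "\<alpha> \<subseteq>\<^sub>m \<beta>" "I \<subseteq> J" by blast
  then obtain \<gamma> where \<gamma>: "attach \<beta> \<gamma>" "B = supertile_of (\<beta> ++ \<gamma>)" using step_attach step.hyps(2) by blast
  then obtain J' where "good Q s N (\<beta> ++ \<gamma>) J'" "J \<subseteq> J'" using good_attach[OF b(2) _ mx] by blast
  moreover have "\<alpha> \<subseteq>\<^sub>m \<beta> ++ \<gamma>" using b(3) attach_le[OF \<gamma>(1)] map_le_trans by blast
  ultimately show ?case using \<gamma>(2) b(4) by blast
qed

text \<open>The preparatory steps permitted by weak modelling are attachments to a full rack too, so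
  \<open>\<beta>\<close> extends \<open>\<alpha>\<close> and is read in the same grids.\<close>

lemma good_model:
  assumes g: "good Q s N \<alpha> I" and k: "k \<notin> I"
    and mx: "band_max s N"
  shows "\<exists>\<beta> \<gamma>. good Q s N \<beta> I \<and> \<alpha> \<subseteq>\<^sub>m \<beta> \<and> attach \<beta> \<gamma> \<and> plug_like \<gamma> \<and> good Q s N (\<beta> ++ \<gamma>) (insert k I)"
proof -
  have rack_like: "rack_like \<alpha> I" using g unfolding good_def by blast
  let ?A = "supertile_of (rack n I)" and ?B = "supertile_of (rack n (insert k I))"
  have A: "?A \<in> producible (target_init n) 1" using rack_like rep_super_supertile(2)[of \<alpha>] unfolding rack_like_def by simp
  have st: "step (target_init n) 1 ?A ?B" by (rule target_step_rack[OF k n_pos])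
  then have B: "?B \<in> producible (target_init n) 1" using producible.combine[OF A] unfolding step_def by blast
  have \<alpha>: "supertile_of \<alpha> \<in> producible SU \<tau>'" "rep_super m R (supertile_of \<alpha>) = ?A"
    using rack_like rep_super_supertile(1) unfolding rack_like_def by auto
  obtain A2 B2 where A2: "A2 \<in> producible SU \<tau>'" "rep_super m R A2 = ?A" "steps SU \<tau>' (supertile_of \<alpha>) A2"
    and B2: "B2 \<in> producible SU \<tau>'" "rep_super m R B2 = ?B" "step SU \<tau>' A2 B2"
    using sim[unfolded simulates_def, THEN conjunct2, THEN conjunct2, THEN conjunct2, THEN conjunct2,
        rule_format, OF A B st \<alpha>] by (elim bexE conjE)
  obtain \<beta> J where b: "A2 = supertile_of \<beta>" "good Q s N \<beta> J" "\<alpha> \<subseteq>\<^sub>m \<beta>"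
    using good_steps[OF A2(3) g mx] by blast
  have "J = I" using A2(1,2) b(1,2) rep_super_supertile(1)[of \<beta>] rack_supertile_inject
    unfolding good_def rack_like_def by metis
  obtain \<gamma> where \<gamma>: "attach \<beta> \<gamma>" "B2 = supertile_of (\<beta> ++ \<gamma>)" using step_attach B2(3) b(1) by blast
  obtain J' where J': "plug_like \<gamma>" "good Q s N (\<beta> ++ \<gamma>) J'" using good_attach[OF b(2) \<gamma>(1) mx] by blast
  have "J' = insert k I" using B2(1,2) \<gamma>(2) J'(2) rep_super_supertile(1)[of "\<beta> ++ \<gamma>"] rack_supertile_inject
    unfolding good_def rack_like_def by metis
  then show ?thesis using b \<gamma>(1) J' \<open>J = I\<close> by blast
qed

lemma pigeonhole:
  assumes "\<And>j. j < n \<Longrightarrow> set (f j) \<subseteq> insert None (Some ` U) \<and> length (f j) = 4"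
  shows "\<exists>i<n. \<exists>j<n. i \<noteq> j \<and> f i = f j"
proof (rule ccontr)
  assume "\<not> ?thesis"
  then have "inj_on f {..<n}" by (auto simp: inj_on_def)
  let ?V = "insert None (Some ` U)"
  have fin: "finite ?V" using finite_U by simp
  have "f ` {..<n} \<subseteq> {xs. set xs \<subseteq> ?V \<and> length xs = 4}" using assms by auto
  then have "card (f ` {..<n}) \<le> card {xs. set xs \<subseteq> ?V \<and> length xs = 4}"
    by (rule card_mono[OF finite_lists_length_eq[OF fin]])
  also have "\<dots> = card ?V ^ 4" by (rule card_lists_length_eq[OF fin])
  also have "card ?V = card U + 1" using finite_U by (simp add: card_image)
  finally show False using card_image[OF \<open>inj_on f {..<n}\<close>] n_eq by simp
qed

text \<open>Blocks of at most four tiles cannot tell \<open>n\<close> types of hooks apart.\<close>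
lemma m_ge_3: "M \<ge> 3"
proof (rule ccontr)
  assume "\<not> M \<ge> 3"
  then have m2: "M \<le> 2" by simp
  have "supertile_of (rack n {}) \<in> producible (target_init n) 1"
    by (intro producible.init) (simp add: target_init_def)
  then obtain \<alpha> where \<alpha>: "rack_like \<alpha> {}" using prodU_exists unfolding rack_like_def by blast
  then obtain z w where r: "reads (rack n {}) \<alpha> (0 + M * z) (0 + M * w)" using rack_like_reads by blast
  let ?x = "M * z + M" and ?y = "\<lambda>j. M * w + M * row j"
  define f where "f j = [\<alpha> (?x, ?y j), \<alpha> (?x + 1, ?y j), \<alpha> (?x, ?y j + 1), \<alpha> (?x + 1, ?y j + 1)]" for j
  have "\<alpha> p \<in> insert None (Some ` U)" for p
    using \<alpha> prodU_tile[of \<alpha> p] unfolding rack_like_def by (cases "\<alpha> p") auto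
  then obtain i j where ij: "i < n" "j < n" "i \<noteq> j" "f i = f j"
    using pigeonhole[of f] unfolding f_def by auto
  have "win \<alpha> ?x (?y i) = win \<alpha> ?x (?y j)"
  proof (rule ext, clarify)
    fix k l
    show "win \<alpha> ?x (?y i) (k, l) = win \<alpha> ?x (?y j) (k, l)"
    proof (cases "k < m \<and> l < m")
      case True
      then have "(k = 0 \<or> k = 1) \<and> (l = 0 \<or> l = 1)" using m2 by linarith
      then show ?thesis using ij(4) True unfolding f_def win_def by auto
    qed (auto simp: win_def)
  qed
  moreover have "R (win \<alpha> ?x (?y k)) = Some (hook (k mod n))" for k
  proof -
    have "R (win \<alpha> (0 + M * z + M * 1) (0 + M * w + M * row k)) = rack n {} (1, row k)"
      using r unfolding reads_def by blast
    then show ?thesis by simp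
  qed
  ultimately have "i mod n = j mod n" by (metis option.inject tile_distinct(21))
  then show False using ij by simp
qed

end

subsection \<open>Exchanging plugs\<close>

text \<open>\<open>A j\<close> is the rack grown from \<open>\<alpha>\<close> at the moment when the
  plug \<open>\<gamma> j\<close> goes to \<open>slot j\<close>. All exchanges use the one host
  \<open>\<alpha>\<close>: by \<open>A_eq\<close> each \<open>A j\<close> agrees with it near its
  slot, and its stability must be demanded because initial supertiles may be unstable.\<close>

locale pinched_simulation = simulation U SU \<tau>' m n R + pinch "int m" Q
  for U SU \<tau>' m n R Q +
  fixes s :: int and N :: nat and \<alpha> :: assembly and I :: "nat set" and slot :: "nat \<Rightarrow> nat"
    and A \<gamma> :: "nat \<Rightarrow> assembly"
  assumes good_\<alpha>: "good Q s N \<alpha> I" and band: "band_max s N" and stable_\<alpha>: "stable \<tau>' \<alpha>"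
    and slot_mod: "\<And>j. j < n \<Longrightarrow> slot j mod n = j" and slot_I: "\<And>j. j < n \<Longrightarrow> slot j \<notin> I"
    and good_A: "\<And>j. j < n \<Longrightarrow> good Q s N (A j) I" and le_A: "\<And>j. j < n \<Longrightarrow> \<alpha> \<subseteq>\<^sub>m A j"
    and att_A: "\<And>j. j < n \<Longrightarrow> attach (A j) (\<gamma> j)" and plug_like_\<gamma>: "\<And>j. j < n \<Longrightarrow> plug_like (\<gamma> j)"
    and good_A\<gamma>: "\<And>j. j < n \<Longrightarrow> good Q s N (A j ++ \<gamma> j) (insert (slot j) I)"
    and A_eq: "\<And>j x y. j < n \<Longrightarrow> (x, y) \<in> dom (A j) \<Longrightarrow>
       (\<And>u v. (u, v) \<in> Q \<Longrightarrow> v + M * (row (slot j) - 2) \<le> y \<and> y < v + M * (row (slot j) + 3)) \<Longrightarrow>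
       A j (x, y) = \<alpha> (x, y)"
begin

abbreviation bump :: "nat \<Rightarrow> int" where "bump j \<equiv> row (slot j)"

text \<open>These are the coordinates of \<open>rack_ok\<close> and \<open>plug_ok\<close>: rows are
  counted from the slot, and the shift by \<open>2 * M\<close> is there because plug cells are in
  column 2 of the rack.\<close>

definition rack_at :: "nat \<Rightarrow> int \<Rightarrow> int \<Rightarrow> tile option" where
  "rack_at j X r = \<alpha> (X + 2 * M, r + M * bump j)"

definition plug_at :: "nat \<Rightarrow> int \<Rightarrow> int \<Rightarrow> tile option" where
  "plug_at j X r = \<gamma> j (X + 2 * M, r + M * bump j)"

text \<open>One cell more on either side than plug tiles reach, to include their neighbours.\<close>

definition nearby :: "int \<Rightarrow> bool" where
  "nearby r \<longleftrightarrow> (\<forall>(u, v)\<in>Q. v - 2 * M \<le> r \<and> r < v + 3 * M)"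

definition touch :: "nat \<Rightarrow> int \<Rightarrow> int \<Rightarrow> bool" where
  "touch j X r \<longleftrightarrow> rack_at j X r \<noteq> None \<and> (plug_at j (X + 1) r \<noteq> None \<or> plug_at j (X - 1) r \<noteq> None \<or>
     plug_at j X (r + 1) \<noteq> None \<or> plug_at j X (r - 1) \<noteq> None)"

lemma M_less: "M * X < M * Y \<longleftrightarrow> X < Y" for X Y
  using M_pos by simp

lemma cell_le:
  assumes "u + M * X \<le> x" "x < u + M * Y + M"
  shows "X \<le> Y"
proof -
  have "M * X < M * (Y + 1)" using assms by (simp add: distrib_left)
  then show ?thesis unfolding M_less by simp
qed

lemma good_reads: "good Q s N \<beta> J \<Longrightarrow> (u, v) \<in> Q \<Longrightarrow> reads (rack n J) \<beta> u v"
  unfolding good_def by blast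

lemma good_nonempty: "good Q s N \<beta> J \<Longrightarrow> dom \<beta> \<noteq> {}"
proof -
  assume g: "good Q s N \<beta> J"
  obtain u v where "(u, v) \<in> Q" using cover by blast
  then have r: "reads (rack n J) \<beta> u v" by (rule good_reads[OF g])
  have "(0, 0) \<in> dom (rack n J)" by (simp add: in_dom_rack_iff)
  from reads_tile[OF r this] show ?thesis by blast
qed

text \<open>No other hook row is within distance 3 of the free slot, so the spine and one hook are
  all that a cell in this range can be next to.\<close>

lemma cell_cases:
  assumes "j < n" "near (rack n I) X Y" "bump j - 2 \<le> Y" "Y \<le> bump j + 2"
  shows "X \<le> 1 \<or> X = 2 \<and> Y = bump j"
proof -
  have *: "k' = slot j" if "row k' - bump j \<le> 3" "bump j - row k' \<le> 3" for k'
    using row_gap[of k' "slot j"] that by linarith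
  have row: "x = 0 \<or> x = 1 \<and> y = bump j" if d: "(x, y) \<in> dom (rack n I)" "bump j - 3 \<le> y" "y \<le> bump j + 3" for x y
  proof -
    consider "x = 0" | k where "y = row k" "x = 1 \<or> k \<in> I" using d(1) unfolding in_dom_rack_iff by blast
    then show ?thesis
    proof cases
      case 2
      then have "k = slot j" using d(2,3) by (intro *) auto
      then show ?thesis using 2 slot_I[OF assms(1)] by blast
    qed simp
  qed
  obtain d e where de: "(X + d, Y + e) \<in> dom (rack n I)" "d = - 1 \<and> e = 0 \<or> 0 \<le> d" "\<bar>e\<bar> \<le> 1"
  proof -
    note that[of 0 0] that[of 1 0] that[of "- 1" 0] that[of 0 1] that[of 0 "- 1"]
    then show thesis using assms(2) unfolding near_def by (elim disjE) simp_all
  qed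
  have "bump j - 3 \<le> Y + e" "Y + e \<le> bump j + 3" using assms(3,4) de(3) by auto
  then have "X + d = 0 \<or> X + d = 1 \<and> Y + e = bump j" by (rule row[OF de(1)])
  then show ?thesis using de(2) by auto
qed

lemma good_rack_ok:
  assumes j: "j < n" and g: "good Q s N \<beta> I" and d: "(x, y) \<in> dom \<beta>" and nb: "nearby (y - M * bump j)"
  shows "rack_ok (x - 2 * M) (y - M * bump j)"
  unfolding rack_ok_def
proof (clarify)
  fix u v assume q: "(u, v) \<in> Q"
  then have "reads (rack n I) \<beta> u v" using g unfolding good_def by blast
  from reads_cell[OF this d] obtain X Y where X: "u + M * X \<le> x" "x < u + M * X + M"
    and Y: "v + M * Y \<le> y" "y < v + M * Y + M" and nr: "near (rack n I) X Y" by blast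
  have v: "v - 2 * M \<le> y - M * bump j" "y - M * bump j < v + 3 * M" using nb q unfolding nearby_def by auto
  have "M * (bump j - 3) < M * Y" "M * Y < M * (bump j + 3)" using v Y by (simp_all add: algebra_simps)
  then have "bump j - 2 \<le> Y" "Y \<le> bump j + 2" unfolding M_less by linarith+
  then have c: "X \<le> 1 \<or> X = 2 \<and> Y = bump j" using cell_cases j nr by blast
  have "M * X \<le> M * 2" using c by (intro M_mono) auto
  moreover have "Y = bump j" if "u \<le> x - 2 * M"
  proof -
    have "M * 1 < M * X" using that X(2) by simp
    then have "1 < X" unfolding M_less .
    then show ?thesis using c by linarith
  qed
  ultimately show "x - 2 * M < u + M \<and> (u \<le> x - 2 * M \<longrightarrow> v \<le> y - M * bump j \<and> y - M * bump j < v + M)"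
    using X Y by (intro conjI impI; (linarith | fastforce))
qed

text \<open>At first the grid of the plug is known only up to cells, and its type not at all. The
  cell of \<open>plugR\<close> is two columns east of the hook and free of tiles of
  \<open>A j\<close>, so its block in the union is that of \<open>\<gamma> j\<close>; it fixes
  both.\<close>

lemma \<gamma>_reads:
  assumes j: "j < n" and q: "(u, v) \<in> Q"
  shows "reads (plug j) (\<gamma> j) (u + 2 * M) (v + M * bump j)"
proof -
  have rA: "reads (rack n I) (A j) u v" using good_A[OF j] q unfolding good_def by blast
  have rA\<gamma>: "reads (rack n (insert (slot j) I)) (A j ++ \<gamma> j) u v" using good_A\<gamma>[OF j] q unfolding good_def by blast
  obtain j' z w where r: "reads (plug j') (\<gamma> j) (u + M * z) (v + M * w)" using plug_like_reads[OF plug_like_\<gamma>[OF j]] by blast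
  have "win (A j ++ \<gamma> j) (u + M * 3) (v + M * bump j) = win (\<gamma> j) (u + M * 3) (v + M * bump j)"
  proof (rule win_cong)
    fix x y assume h: "u + M * 3 \<le> x" "x < u + M * 3 + M" "v + M * bump j \<le> y" "y < v + M * bump j + M"
    have "(x, y) \<notin> dom (A j)"
    proof
      assume d: "(x, y) \<in> dom (A j)"
      from reads_cell[OF rA d] obtain X Y where X: "u + M * X \<le> x" "x < u + M * X + M"
        and Y: "v + M * Y \<le> y" "y < v + M * Y + M" and nr: "near (rack n I) X Y" by blast
      have "3 \<le> X" "Y = bump j" using cell_le[OF h(1) X(2)] cell_le[OF h(3) Y(2)] cell_le[OF Y(1) h(4)] by auto
      then show False using cell_cases[OF j nr] by simp
    qed
    then show "(A j ++ \<gamma> j) (x, y) = \<gamma> j (x, y)" by (simp add: map_add_def domIff split: option.splits)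
  qed
  then have "R (win (\<gamma> j) (u + M * 3) (v + M * bump j)) = rack n (insert (slot j) I) (3, bump j)"
    using rA\<gamma> unfolding reads_def by metis
  then have *: "R (win (\<gamma> j) (u + M * 3) (v + M * bump j)) = Some (plugR j)" using slot_mod[OF j] by simp
  have "R (win (\<gamma> j) (u + M * z + M * (3 - z)) (v + M * w + M * (bump j - w))) = plug j' (3 - z, bump j - w)"
    using r unfolding reads_def by blast
  then have "plug j' (3 - z, bump j - w) = Some (plugR j)" using * by (simp add: algebra_simps)
  then have "z = 2" "w = bump j" "j' = j" by (auto simp: plug_Some_iff)
  then show ?thesis using r by (simp add: mult.commute)
qed

lemma plug_at_plug_ok:
  assumes j: "j < n" and g: "plug_at j X r \<noteq> None"
  shows "plug_ok X r \<and> (\<forall>(u, v)\<in>Q. v - M \<le> r \<and> r < v + 2 * M)"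
proof -
  have "(u - M \<le> X \<and> (X < u \<longrightarrow> v \<le> r \<and> r < v + M)) \<and> (v - M \<le> r \<and> r < v + 2 * M)" if q: "(u, v) \<in> Q" for u v
  proof -
    have d: "(X + 2 * M, r + M * bump j) \<in> dom (\<gamma> j)" using g unfolding plug_at_def by auto
    from reads_cell[OF \<gamma>_reads[OF j q] d] obtain X' Y' where
      X: "u + 2 * M + M * X' \<le> X + 2 * M" "X + 2 * M < u + 2 * M + M * X' + M"
      and Y: "v + M * bump j + M * Y' \<le> r + M * bump j" "r + M * bump j < v + M * bump j + M * Y' + M"
      and nr: "near (plug j) X' Y'" by blast
    have c: "- 1 \<le> X'" "- 1 \<le> Y'" "Y' \<le> 1" "X' = - 1 \<Longrightarrow> Y' = 0" using nr unfolding near_def dom_plug by auto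
    have m: "M * (- 1) \<le> M * X'" "M * (- 1) \<le> M * Y'" "M * Y' \<le> M * 1" using c by - (rule M_mono, assumption)+
    have "Y' = 0" if "X < u"
    proof -
      have "M * X' < M * 0" using that X by simp
      then have "X' < 0" unfolding M_less .
      then show ?thesis using c by linarith
    qed
    then show ?thesis using X Y m by (intro conjI impI; (linarith | fastforce))
  qed
  then show ?thesis unfolding plug_ok_def by blast
qed

lemma plug_at_nearby:
  assumes "j < n" "plug_at j X r \<noteq> None" "\<bar>r' - r\<bar> \<le> 1"
  shows "nearby r'"
  unfolding nearby_def using plug_at_plug_ok[OF assms(1,2)] assms(3) m3 by fastforce

lemma A_rack_at:
  assumes j: "j < n" and d: "A j (X + 2 * M, r + M * bump j) \<noteq> None" and nb: "nearby r"
  shows "rack_at j X r = A j (X + 2 * M, r + M * bump j)"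
proof -
  have "A j (X + 2 * M, r + M * bump j) = \<alpha> (X + 2 * M, r + M * bump j)"
  proof (rule A_eq[OF j])
    show "(X + 2 * M, r + M * bump j) \<in> dom (A j)" using d by blast
    fix u v assume "(u, v) \<in> Q"
    then have "v - 2 * M \<le> r" "r < v + 3 * M" using nb unfolding nearby_def by auto
    then show "v + M * (bump j - 2) \<le> r + M * bump j \<and> r + M * bump j < v + M * (bump j + 3)" by (simp add: algebra_simps)
  qed
  then show ?thesis unfolding rack_at_def by simp
qed

lemma rack_at_rack_ok: "j < n \<Longrightarrow> rack_at j X r \<noteq> None \<Longrightarrow> nearby r \<Longrightarrow> rack_ok X r"
  using good_rack_ok[OF _ good_\<alpha>, of j "X + 2 * M" "r + M * bump j"] unfolding rack_at_def by auto

lemma dom_\<alpha>_A: "j < n \<Longrightarrow> dom \<alpha> \<subseteq> dom (A j)"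
  using le_A map_le_implies_dom_le by blast

lemma rack_at_plug_at_disjoint: "j < n \<Longrightarrow> rack_at j X r = None \<or> plug_at j X r = None"
  using att_A dom_\<alpha>_A[of j] unfolding attach_def rack_at_def plug_at_def by blast

lemma bond_touch:
  assumes j: "j < n" and p: "(x, y) \<in> dom (A j)" and q: "(x', y') \<in> dom (\<gamma> j)"
    and bd: "bond (A j ++ \<gamma> j) (x, y) (x', y') > 0 \<or> bond (A j ++ \<gamma> j) (x', y') (x, y) > 0"
  shows "touch j (x - 2 * M) (y - M * bump j)" "rack_at j (x - 2 * M) (y - M * bump j) = A j (x, y)"
proof -
  let ?X = "x - 2 * M" and ?r = "y - M * bump j"
  have g: "plug_at j (x' - 2 * M) (y' - M * bump j) \<noteq> None" using q unfolding plug_at_def by auto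
  have adj: "(x' = x + 1 \<and> y' = y) \<or> (x' = x - 1 \<and> y' = y) \<or> (x' = x \<and> y' = y + 1) \<or> (x' = x \<and> y' = y - 1)"
    using bd unfolding bond_pos_iff by auto
  have "nearby ?r" using adj by (intro plug_at_nearby[OF j g]) auto
  then show rack_at: "rack_at j ?X ?r = A j (x, y)" using A_rack_at[OF j, of ?X ?r] p by auto
  have rack_at': "rack_at j ?X ?r \<noteq> None" using rack_at p by auto
  have ca: "x + 1 - 2 * M = ?X + 1" "x - 1 - 2 * M = ?X - 1" "y + 1 - M * bump j = ?r + 1" "y - 1 - M * bump j = ?r - 1" by auto
  have "plug_at j (?X + 1) ?r \<noteq> None \<or> plug_at j (?X - 1) ?r \<noteq> None \<or> plug_at j ?X (?r + 1) \<noteq> None \<or> plug_at j ?X (?r - 1) \<noteq> None"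
    using adj g ca by metis
  then show "touch j ?X ?r" unfolding touch_def using rack_at' by blast
qed

lemma touch_exists: "j < n \<Longrightarrow> \<exists>X r. touch j X r"
proof -
  assume j: "j < n"
  have dis: "dom (A j) \<inter> dom (\<gamma> j) = {}" and st: "stable \<tau>' (A j ++ \<gamma> j)" using att_A[OF j] unfolding attach_def by auto
  obtain u v where q: "(u, v) \<in> Q" using cover by blast
  have neA: "dom (A j) \<noteq> {}" using good_nonempty[OF good_A[OF j]] .
  have ne\<gamma>: "dom (\<gamma> j) \<noteq> {}" using reads_tile[OF \<gamma>_reads[OF j q], of 0 0] by (auto simp: dom_plug)
  have "dom (\<gamma> j) \<noteq> dom (A j ++ \<gamma> j)" using neA dis unfolding dom_map_add by blast
  then have "cut_ge \<tau>' (A j ++ \<gamma> j) (dom (\<gamma> j))" using ne\<gamma> by (intro stableD[OF st]) auto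
  then obtain p q where pq: "bond (A j ++ \<gamma> j) p q > 0" "(p \<in> dom (\<gamma> j)) \<noteq> (q \<in> dom (\<gamma> j))"
    using cut_ge_bond \<tau>'_pos by blast
  have d: "p \<in> dom (A j) \<union> dom (\<gamma> j)" "q \<in> dom (A j) \<union> dom (\<gamma> j)" using bond_pos_dom[OF pq(1)] by auto
  obtain x y x' y' where xy: "p = (x, y)" "q = (x', y')" by fastforce
  show ?thesis
  proof (cases "p \<in> dom (\<gamma> j)")
    case True
    then have "(x', y') \<in> dom (A j)" "(x, y) \<in> dom (\<gamma> j)" using pq(2) d xy by auto
    from bond_touch(1)[OF j this] show ?thesis using pq(1) unfolding xy by blast
  next
    case False
    then have "(x, y) \<in> dom (A j)" "(x', y') \<in> dom (\<gamma> j)" using pq(2) d xy by auto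
    from bond_touch(1)[OF j this] show ?thesis using pq(1) unfolding xy by blast
  qed
qed

text \<open>The moved plug attaches legally, and its block for \<open>plugR j\<close> is intact in a
  grid shifted by \<open>\<delta>\<close>, but in the row of a hook of type
  \<open>i\<close>.\<close>

lemma transfer:
  assumes ij: "i < n" "j < n" "i \<noteq> j" and \<delta>: "\<delta> \<ge> 0"
    and dis: "\<And>X r. plug_at j X r \<noteq> None \<Longrightarrow> rack_at i (X + \<delta>) r = None"
    and con: "\<And>X r. touch j X r \<Longrightarrow> rack_at i (X + \<delta>) r = rack_at j X r"
    and q: "(u, v) \<in> Q" "(u + \<delta> + M * z, v) \<in> Q"
  shows False
proof -
  let ?c = "M * bump i - M * bump j"
  let ?\<gamma> = "translate (\<gamma> j) (\<delta>, ?c)"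
  have disj: "dom \<alpha> \<inter> dom ?\<gamma> = {}"
  proof (rule ccontr)
    assume "dom \<alpha> \<inter> dom ?\<gamma> \<noteq> {}"
    then obtain x y where xy: "(x, y) \<in> dom \<alpha>" "(x, y) \<in> dom ?\<gamma>" by fastforce
    then have "plug_at j (x - \<delta> - 2 * M) (y - M * bump i) \<noteq> None" unfolding plug_at_def by (auto simp: algebra_simps)
    from dis[OF this] show False using xy(1) unfolding rack_at_def by (auto simp: algebra_simps)
  qed
  have "stable \<tau>' (\<alpha> ++ ?\<gamma>)"
  proof (intro stable_partner_transfer[OF _ _ _ stable_\<alpha> disj])
    show "stable \<tau>' (A j ++ \<gamma> j)" "dom (A j) \<inter> dom (\<gamma> j) = {}" using att_A[OF ij(2)] unfolding attach_def by auto
    show "dom (A j) \<noteq> {}" using good_nonempty[OF good_A[OF ij(2)]] .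
    fix x y x' y'
    assume h: "(x, y) \<in> dom (A j)" "(x', y') \<in> dom (\<gamma> j)"
      "bond (A j ++ \<gamma> j) (x, y) (x', y') > 0 \<or> bond (A j ++ \<gamma> j) (x', y') (x, y) > 0"
    have "rack_at i (x - 2 * M + \<delta>) (y - M * bump j) = A j (x, y)"
      using con[OF bond_touch(1)[OF ij(2) h]] bond_touch(2)[OF ij(2) h] by simp
    then show "\<alpha> (x + \<delta>, y + ?c) = A j (x, y)" unfolding rack_at_def by (simp add: algebra_simps)
  qed
  moreover have "prodU ?\<gamma>" using att_A[OF ij(2)] unfolding attach_def by simp
  ultimately have "attach \<alpha> ?\<gamma>" unfolding attach_def using disj by blast
  then obtain I' where "good Q s N (\<alpha> ++ ?\<gamma>) I'" using good_attach[OF good_\<alpha> _ band] by blast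
  then have r: "reads (rack n I') (\<alpha> ++ ?\<gamma>) (u + \<delta> + M * z) v" using q(2) unfolding good_def by blast
  \<comment> \<open>A shift east cannot bring the \<open>plugR\<close> cell back to tiles of
    \<open>\<alpha>\<close>; here \<open>0 \<le> \<delta>\<close> is essential.\<close>
  have w1: "win (\<alpha> ++ ?\<gamma>) (u + \<delta> + 3 * M) (v + M * bump i) = win ?\<gamma> (u + \<delta> + 3 * M) (v + M * bump i)"
  proof (rule win_cong)
    fix x y assume h: "u + \<delta> + 3 * M \<le> x" "x < u + \<delta> + 3 * M + M" "v + M * bump i \<le> y" "y < v + M * bump i + M"
    have "(x, y) \<notin> dom \<alpha>"
    proof
      assume d: "(x, y) \<in> dom \<alpha>"
      have "reads (rack n I) \<alpha> u v" using good_\<alpha> q(1) unfolding good_def by blast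
      from reads_cell[OF this d] obtain X Y where X: "u + M * X \<le> x" "x < u + M * X + M"
        and Y: "v + M * Y \<le> y" "y < v + M * Y + M" and nr: "near (rack n I) X Y" by blast
      have "u + M * 3 \<le> x" using h(1) \<delta> by simp
      then have "3 \<le> X" "Y = bump i" using cell_le[OF _ X(2)] cell_le[OF h(3) Y(2)] cell_le[OF Y(1) h(4)] by auto
      then show False using cell_cases[OF ij(1) nr] by simp
    qed
    then show "(\<alpha> ++ ?\<gamma>) (x, y) = ?\<gamma> (x, y)" by (simp add: map_add_def domIff split: option.splits)
  qed
  have w2: "win ?\<gamma> (u + \<delta> + 3 * M) (v + M * bump i) = win (\<gamma> j) (u + 2 * M + M * 1) (v + M * bump j + M * 0)"
    unfolding win_def by (auto simp: fun_eq_iff algebra_simps)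
  have "R (win (\<gamma> j) (u + 2 * M + M * 1) (v + M * bump j + M * 0)) = plug j (1, 0)"
    using \<gamma>_reads[OF ij(2) q(1)] unfolding reads_def by blast
  then have "R (win (\<alpha> ++ ?\<gamma>) (u + \<delta> + 3 * M) (v + M * bump i)) = Some (plugR j)"
    unfolding w1 w2 by (simp add: plug_def)
  moreover have "R (win (\<alpha> ++ ?\<gamma>) (u + \<delta> + M * z + M * (3 - z)) (v + M * bump i)) = rack n I' (3 - z, bump i)"
    using r unfolding reads_def by blast
  ultimately have "rack n I' (3 - z, bump i) = Some (plugR j)" by (simp add: algebra_simps)
  then have "slot i mod n = j" by (auto simp: rack_Some_iff split: if_splits)
  then show False using slot_mod[OF ij(1)] ij(3) by simp
qed

text \<open>The rack cannot get past a plug tile in the common row, because it is connected.\<close>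
lemma barrier:
  assumes j: "j < n" and c: "common c" and g: "plug_at j g c \<noteq> None" and a: "rack_at j X r \<noteq> None" and nb: "nearby r"
  shows "X \<le> g \<and> (r = c \<longrightarrow> X < g)"
proof -
  have plug_ok: "plug_ok g c" using plug_at_plug_ok[OF j g] by blast
  have nbc: "nearby r'" if "\<bar>r' - c\<bar> \<le> 1" for r' using plug_at_nearby[OF j g that] .
  let ?y = "c + M * bump j"
  \<comment> \<open>The rack tiles of the common row beyond the plug tile. They bond to no other
    rack tile: \<open>beyond_row\<close> empties the cells above and below, and the plug tile blocks
    the west. A nonempty \<open>D\<close> would be a cut of weight 0.\<close>
  define D where "D = {(x, y) \<in> dom \<alpha>. y = ?y \<and> x > g + 2 * M}"
  have "D = {}"
  proof (rule ccontr)
    assume "D \<noteq> {}"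
    obtain u v where q: "(u, v) \<in> Q" using cover by blast
    have rd: "reads (rack n I) \<alpha> u v" using good_\<alpha> q unfolding good_def by blast
    \<comment> \<open>A row of cells entirely above the common row; the spine has a tile there, so
      \<open>D\<close> is not the whole rack.\<close>
    let ?Y = "(?y - v) div M + 1"
    obtain x y where xy: "(x, y) \<in> dom \<alpha>" "v + M * ?Y \<le> y"
      using reads_tile[OF rd, of 0 ?Y] by (auto simp: in_dom_rack_iff)
    have "?y - v < M * ?Y"
    proof -
      have "M * ((?y - v) div M) + (?y - v) mod M = ?y - v" "(?y - v) mod M < M"
        using M_pos by (auto simp: mult_div_mod_eq)
      then show ?thesis unfolding distrib_left by linarith
    qed
    then have "(x, y) \<notin> D" using xy(2) unfolding D_def by simp
    then have "D \<noteq> dom \<alpha>" using xy(1) by blast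
    then have "cut_ge \<tau>' \<alpha> D" using \<open>D \<noteq> {}\<close> by (intro stableD[OF stable_\<alpha>]) (auto simp: D_def)
    then obtain p q where pq: "bond \<alpha> p q > 0" "(p \<in> D) \<noteq> (q \<in> D)" using cut_ge_bond \<tau>'_pos by blast
    have dpq: "p \<in> dom \<alpha>" "q \<in> dom \<alpha>" using bond_pos_dom[OF pq(1)] by auto
    obtain x1 y1 x2 y2 where e: "p = (x1, y1)" "q = (x2, y2)" by fastforce
    have adj: "(x2 = x1 + 1 \<and> y2 = y1) \<or> (x2 = x1 \<and> y2 = y1 + 1)"
      using pq(1) unfolding bond_pos_iff e by auto
    have no\<gamma>: "(g + 2 * M, ?y) \<notin> dom \<alpha>" using rack_at_plug_at_disjoint[OF j, of g c] g unfolding rack_at_def by auto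
    have off: "(x, y) \<notin> dom \<alpha>" if "x > g + 2 * M" "\<bar>y - ?y\<bar> = 1" for x y
    proof
      assume "(x, y) \<in> dom \<alpha>"
      then have "rack_at j (x - 2 * M) (y - M * bump j) \<noteq> None" unfolding rack_at_def by auto
      then have "rack_ok (x - 2 * M) (y - M * bump j)" using that(2) by (intro rack_at_rack_ok[OF j] nbc) auto
      then have "y - M * bump j = c" by (rule beyond_row[OF c plug_ok]) (use that in simp)
      then show False using that(2) by simp
    qed
    show False
    proof (cases "p \<in> D")
      case True
      then have "x1 > g + 2 * M" "y1 = ?y" "q \<notin> D" using pq(2) e by (auto simp: D_def)
      then show False using adj off[of x2 y2] dpq e unfolding D_def by auto
    next
      case False
      then have *: "x2 > g + 2 * M" "y2 = ?y" "p \<notin> D" using pq(2) e by (auto simp: D_def)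
      then have "x1 = g + 2 * M \<or> x1 > g + 2 * M" using adj by auto
      then show False using * adj off[of x1 y1] dpq e no\<gamma> unfolding D_def by auto
    qed
  qed
  have "X \<le> g"
  proof (rule ccontr)
    assume "\<not> X \<le> g"
    then have "g < X" by simp
    then have "r = c" by (rule beyond_row[OF c plug_ok rack_at_rack_ok[OF j a nb]])
    then have "(X + 2 * M, ?y) \<in> D" using a \<open>g < X\<close> unfolding D_def rack_at_def by auto
    then show False using \<open>D = {}\<close> by blast
  qed
  moreover have "X \<noteq> g" if "r = c" using rack_at_plug_at_disjoint[OF j, of g c] g a that by auto
  ultimately show ?thesis by auto
qed

lemma rack_at_in: "rack_at j X r \<in> insert None (Some ` U)"
  using prodU_tile[of \<alpha> "(X + 2 * M, r + M * bump j)"] good_\<alpha> unfolding rack_at_def good_def rack_like_def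
  by (cases "\<alpha> (X + 2 * M, r + M * bump j)") auto

lemma touch_rack_ok: "j < n \<Longrightarrow> touch j X r \<Longrightarrow> rack_ok X r \<and> nearby r"
proof -
  assume j: "j < n" and t: "touch j X r"
  have "nearby r"
    using t plug_at_nearby[OF j, of "X + 1" r r] plug_at_nearby[OF j, of "X - 1" r r]
      plug_at_nearby[OF j, of X "r + 1" r] plug_at_nearby[OF j, of X "r - 1" r] unfolding touch_def by auto
  then show ?thesis using rack_at_rack_ok[OF j] t unfolding touch_def by blast
qed

text \<open>Otherwise each of the directions east, north and south has at most one contact position,
  the same for all types, and west has none. Two types with equal rack tiles there are exchanged
  without any horizontal shift.\<close>

lemma common_row_exists: "\<exists>c. common c"
proof (rule ccontr)
  assume "\<nexists>c. common c"
  then have nc: "\<And>c. \<not> common c" by blast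
  \<comment> \<open>The only possible position, or an arbitrary one if there is none.\<close>
  define E where "E = (SOME p. rack_ok (fst p) (snd p) \<and> plug_ok (fst p + 1) (snd p))"
  define No where "No = (SOME p. rack_ok (fst p) (snd p) \<and> plug_ok (fst p) (snd p + 1))"
  define So where "So = (SOME p. rack_ok (fst p) (snd p) \<and> plug_ok (fst p) (snd p - 1))"
  have E: "(X, r) = E" if "rack_ok X r" "plug_ok (X + 1) r" for X r
  proof -
    have "rack_ok (fst E) (snd E) \<and> plug_ok (fst E + 1) (snd E)" unfolding E_def by (rule someI[of _ "(X, r)"]) (use that in auto)
    then show ?thesis using east_unique[OF nc that] by (metis prod.collapse)
  qed
  have No: "(X, r) = No" if "rack_ok X r" "plug_ok X (r + 1)" for X r
  proof -
    have "rack_ok (fst No) (snd No) \<and> plug_ok (fst No) (snd No + 1)" unfolding No_def by (rule someI[of _ "(X, r)"]) (use that in auto)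
    then show ?thesis using north_unique[OF nc that] by (metis prod.collapse)
  qed
  have So: "(X, r) = So" if "rack_ok X r" "plug_ok X (r - 1)" for X r
  proof -
    have "rack_ok (fst So) (snd So) \<and> plug_ok (fst So) (snd So - 1)" unfolding So_def by (rule someI[of _ "(X, r)"]) (use that in auto)
    then show ?thesis using south_unique[OF nc that] by (metis prod.collapse)
  qed
  \<comment> \<open>Three positions suffice here; \<open>None\<close> pads the list to length
    four.\<close>
  define f where "f j = [rack_at j (fst E) (snd E), rack_at j (fst No) (snd No), rack_at j (fst So) (snd So), None]" for j
  obtain i j where ij: "i < n" "j < n" "i \<noteq> j" "f i = f j"
    using pigeonhole[of f] rack_at_in unfolding f_def by auto
  obtain u v where q: "(u, v) \<in> Q" using cover by blast
  show False
  proof (rule transfer[OF ij(1-3), of 0 u v 0])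
    fix X r assume g: "plug_at j X r \<noteq> None"
    show "rack_at i (X + 0) r = None"
    proof (rule ccontr)
      assume "rack_at i (X + 0) r \<noteq> None"
      then have "rack_ok X r" using rack_at_rack_ok[OF ij(1)] plug_at_nearby[OF ij(2) g] by auto
      then show False using rack_plug_ok_common[of X r X] plug_at_plug_ok[OF ij(2) g] nc by auto
    qed
  next
    fix X r assume t: "touch j X r"
    have a: "rack_ok X r" using touch_rack_ok[OF ij(2) t] by blast
    have "\<not> plug_ok (X - 1) r" using rack_plug_ok_common[OF a, of "X - 1"] nc by auto
    then consider "plug_ok (X + 1) r" | "plug_ok X (r + 1)" | "plug_ok X (r - 1)"
      using t plug_at_plug_ok[OF ij(2)] unfolding touch_def by blast
    then have "(X, r) = E \<or> (X, r) = No \<or> (X, r) = So" using E No So a by cases blast+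
    then show "rack_at i (X + 0) r = rack_at j X r" using ij(4) unfolding f_def by (auto simp: prod_eq_iff)
  qed (use q in auto)
qed

text \<open>The extreme column \<open>XR\<close> depends only on \<open>Q\<close> and so is the same
  for all types. The westernmost plug tile \<open>g j\<close> of the common row varies with the
  type, and contacts around it are matched by aligning these tiles.\<close>

lemma contradiction: False
proof -
  obtain c where c: "common c" using common_row_exists by blast
  define isR where "isR X \<longleftrightarrow> (\<forall>X' r'. rack_ok X' r' \<longrightarrow> X' \<le> X) \<and> rack_ok X c" for X
  define XR where "XR = (SOME X. isR X)"
  have XR: "X = XR \<and> isR XR" if "isR X" for X
  proof -
    have "isR XR" unfolding XR_def using that by (rule someI)
    then show ?thesis using that unfolding isR_def by force
  qed
  define isg where "isg j g \<longleftrightarrow> plug_at j g c \<noteq> None \<and> (\<forall>g'. plug_at j g' c \<noteq> None \<longrightarrow> g \<le> g')" for j g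
  define g where "g j = (SOME x. isg j x)" for j
  have g: "x = g j \<and> isg j (g j)" if "isg j x" for j x
  proof -
    have "isg j (g j)" unfolding g_def using that by (rule someI)
    then show ?thesis using that unfolding isg_def by force
  qed
  \<comment> \<open>\<open>None\<close> covers both an empty cell and the absence of an extreme
    column.\<close>
  define e where "e j = (if isR XR then rack_at j XR c else None)" for j
  have nbc: "nearby r" if "\<bar>r - c\<bar> \<le> 1" for r
    unfolding nearby_def using that commonD[OF c] m3 by fastforce
  have cases: "(isR X \<and> r = c) \<or> (\<exists>g. isg j g \<and> ((X = g - 1 \<and> r = c) \<or> (X = g \<and> (r = c + 1 \<or> r = c - 1))))"
    if j: "j < n" and t: "touch j X r" for j X r
  proof -
    have a: "rack_ok X r" and nb: "nearby r" using touch_rack_ok[OF j t] by auto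
    have an: "rack_at j X r \<noteq> None" using t unfolding touch_def by blast
    have II: "isg j X" if "plug_at j X c \<noteq> None" "\<forall>X' r'. plug_ok X' r' \<longrightarrow> X \<le> X'"
      using that plug_at_plug_ok[OF j] unfolding isg_def by blast
    consider "plug_at j (X + 1) r \<noteq> None" | "plug_at j (X - 1) r \<noteq> None" | "plug_at j X (r + 1) \<noteq> None" | "plug_at j X (r - 1) \<noteq> None"
      using t unfolding touch_def by blast
    then show ?thesis
    proof cases
      case 1
      then have r: "r = c" using east_row[OF c a] plug_at_plug_ok[OF j] by blast
      have "X + 1 \<le> g'" if "plug_at j g' c \<noteq> None" for g' using barrier[OF j c that an nb] r by simp
      then have "isg j (X + 1)" using 1 r unfolding isg_def by blast
      then show ?thesis using r by force
    next
      case 2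
      then have "common r" using rack_plug_ok_common[OF a, of "X - 1"] plug_at_plug_ok[OF j] by auto
      then have "r = c" using common_unique c by blast
      then show ?thesis using barrier[OF j c _ an nb, of "X - 1"] 2 by simp
    next
      case 3
      then have "plug_ok X (r + 1)" using plug_at_plug_ok[OF j] by blast
      from north_contact[OF c a this] show ?thesis
      proof
        assume "r = c \<and> (\<forall>X' r'. rack_ok X' r' \<longrightarrow> X' \<le> X)"
        then show ?thesis using a unfolding isR_def by blast
      next
        assume h: "r + 1 = c \<and> (\<forall>X' r'. plug_ok X' r' \<longrightarrow> X \<le> X')"
        then have "isg j X" using II 3 by auto
        then show ?thesis using h by (intro disjI2 exI[of _ X]) auto
      qed
    next
      case 4
      then have "plug_ok X (r - 1)" using plug_at_plug_ok[OF j] by blast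
      from south_contact[OF c a this] show ?thesis
      proof
        assume "r = c \<and> (\<forall>X' r'. rack_ok X' r' \<longrightarrow> X' \<le> X)"
        then show ?thesis using a unfolding isR_def by blast
      next
        assume h: "r - 1 = c \<and> (\<forall>X' r'. plug_ok X' r' \<longrightarrow> X \<le> X')"
        then have "isg j X" using II 4 by auto
        then show ?thesis using h by (intro disjI2 exI[of _ X]) auto
      qed
    qed
  qed
  have row: "common r \<Longrightarrow> r = c" for r using common_unique c by blast
  define f where "f j = [rack_at j (g j - 1) c, rack_at j (g j) (c + 1), rack_at j (g j) (c - 1), e j]" for j
  obtain i0 j0 where ij0: "i0 < n" "j0 < n" "i0 \<noteq> j0" "f i0 = f j0"
  proof -
    have "e j \<in> insert None (Some ` U)" for j unfolding e_def using rack_at_in by simp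
    then have "set (f j) \<subseteq> insert None (Some ` U) \<and> length (f j) = 4" for j
      unfolding f_def using rack_at_in by simp
    then show thesis using pigeonhole[of f] that by blast
  qed
  \<comment> \<open>By symmetry the plug with the more western \<open>g\<close> is the one moved, so
    that the shift goes east.\<close>
  obtain i j where ij: "i < n" "j < n" "i \<noteq> j" "f i = f j" and ge: "g j \<le> g i"
    using ij0 by (metis linear)
  show False
  proof (cases "e j = None")
    case False
    then have R: "isR XR" and aj: "rack_at j XR c \<noteq> None" and eq: "rack_at i XR c = rack_at j XR c"
      using ij(4) unfolding e_def f_def by (auto split: if_splits)
    have beyond: "XR < x" if "plug_at j x c \<noteq> None" for x using barrier[OF ij(2) c that aj nbc] by simp
    have mx: "X \<le> XR" if "rack_ok X r" for X r using R that unfolding isR_def by blast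
    obtain u v where q: "(u, v) \<in> Q" using cover by blast
    show False
    proof (rule transfer[OF ij(1-3), of 0 u v 0])
      fix X r assume gj: "plug_at j X r \<noteq> None"
      show "rack_at i (X + 0) r = None"
      proof (rule ccontr)
        assume "rack_at i (X + 0) r \<noteq> None"
        then have a: "rack_ok X r" using rack_at_rack_ok[OF ij(1)] plug_at_nearby[OF ij(2) gj] by auto
        then have "r = c" using rack_plug_ok_common[of X r X] plug_at_plug_ok[OF ij(2) gj] row by auto
        then show False using beyond[of X] gj mx[OF a] by simp
      qed
    next
      fix X r assume t: "touch j X r"
      have a: "rack_ok X r" using touch_rack_ok[OF ij(2) t] by blast
      have "X = XR \<and> r = c"
        using cases[OF ij(2) t]
      proof
        assume "isR X \<and> r = c" then show ?thesis using XR by blast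
      next
        assume "\<exists>g. isg j g \<and> ((X = g - 1 \<and> r = c) \<or> (X = g \<and> (r = c + 1 \<or> r = c - 1)))"
        then obtain x where x: "isg j x" "(X = x - 1 \<and> r = c) \<or> (X = x \<and> (r = c + 1 \<or> r = c - 1))" by blast
        then have "XR < x" using beyond unfolding isg_def by blast
        then show ?thesis using x(2) mx[OF a] by auto
      qed
      then show "rack_at i (X + 0) r = rack_at j X r" using eq by simp
    qed (use q in auto)
  next
    case True
    then have ei: "e i = None" using ij(4) unfolding f_def by simp
    have touch: "isg k (g k) \<and> ((X = g k - 1 \<and> r = c) \<or> (X = g k \<and> (r = c + 1 \<or> r = c - 1)))"
      if k: "k < n" "e k = None" and t: "touch k X r" for k X r
    proof -
      have "\<not> (isR X \<and> r = c)"
      proof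
        assume h: "isR X \<and> r = c"
        then have "X = XR" "isR XR" using XR by auto
        then have "rack_at k X r = None" using k(2) h unfolding e_def by simp
        then show False using t unfolding touch_def by blast
      qed
      then obtain x where x: "isg k x" "(X = x - 1 \<and> r = c) \<or> (X = x \<and> (r = c + 1 \<or> r = c - 1))"
        using cases[OF k(1) t] by blast
      then show ?thesis using g[OF x(1)] by auto
    qed
    have gi: "isg i (g i)" using touch_exists[OF ij(1)] touch[OF ij(1) ei] by blast
    have gj: "isg j (g j)" using touch_exists[OF ij(2)] touch[OF ij(2) True] by blast
    let ?\<delta> = "g i - g j"
    obtain u v where q: "(u, v) \<in> Q" using cover by blast
    obtain a s where as: "(a, s) \<in> Q" "M dvd a - (u + ?\<delta>)" "M dvd s - v" using cover by blast
    \<comment> \<open>Both bands contain \<open>c\<close>, so their congruent starting rows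
      coincide, as \<open>transfer\<close> requires.\<close>
    have "s = v" by (rule dvd_diff_eq[OF as(3)]) (use commonD[OF c as(1)] commonD[OF c q] in linarith)+
    moreover obtain z where "a = u + ?\<delta> + M * z" using as(2) by (metis add_diff_cancel_left' add_diff_eq diff_add_cancel dvdE add.commute)
    ultimately have q': "(u + ?\<delta> + M * z, v) \<in> Q" using as(1) by simp
    show False
    proof (rule transfer[OF ij(1-3) _ _ _ q q'])
      show "0 \<le> ?\<delta>" using ge by simp
      fix X r assume gX: "plug_at j X r \<noteq> None"
      show "rack_at i (X + ?\<delta>) r = None"
      proof (rule ccontr)
        assume h: "rack_at i (X + ?\<delta>) r \<noteq> None"
        have nb: "nearby r" using plug_at_nearby[OF ij(2) gX] by simp
        have a: "rack_ok (X + ?\<delta>) r" using rack_at_rack_ok[OF ij(1) h nb] .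
        have r: "r = c" using rack_plug_ok_common[OF a, of X] plug_at_plug_ok[OF ij(2) gX] row ge by auto
        \<comment> \<open>In row \<open>c\<close> the rack ends west of \<open>g i\<close>, which is
          where the moved plug begins.\<close>
        have "X + ?\<delta> < g i" using barrier[OF ij(1) c _ h nb, of "g i"] gi r unfolding isg_def by blast
        moreover have "g j \<le> X" using gj gX r unfolding isg_def by blast
        ultimately show False by simp
      qed
    next
      fix X r assume t: "touch j X r"
      have "(X = g j - 1 \<and> r = c) \<or> (X = g j \<and> (r = c + 1 \<or> r = c - 1))" using touch[OF ij(2) True t] by blast
      then show "rack_at i (X + ?\<delta>) r = rack_at j X r" using ij(4) unfolding f_def by auto
    qed
  qed
qed

end

section \<open>Choice of a full rack and conclusion\<close>

lemma row_mono: "k \<le> l \<Longrightarrow> row k \<le> row l"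
  using row_less[of k l] row_ge[of k] by (cases "k = l") auto

text \<open>The host must also be stable, and the racks grown from it must not change near the
  slots. A second maximisation, over the rows around all slots, gives the latter; one extra plug
  gives the former, since results of steps are stable.\<close>

lemma (in simulation) no_simulation: False
proof -
  obtain Q s N \<alpha>1 I1 where g1: "good Q s N \<alpha>1 I1" and finQ: "finite Q"
    and cov: "\<And>u v. \<exists>a b. (a, b) \<in> Q \<and> M dvd a - u \<and> M dvd b - v" and band: "band_max s N"
    using exists_saturated by blast
  have "finite I1" using g1 unfolding good_def by blast
  then obtain B where B: "\<And>i. i \<in> I1 \<Longrightarrow> i < B" using finite_nat_set_iff_bounded[of I1] by auto
  \<comment> \<open>\<open>B\<close> exceeds all hooks in use, and adding a multiple of
    \<open>n\<close> preserves the type.\<close>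
  define slot where "slot j = j + n * B" for j
  have slot_mod: "slot j mod n = j" if "j < n" for j using that by (simp add: slot_def)
  have "B \<le> n * B" using n_pos by simp
  then have "\<not> slot j < B" for j unfolding slot_def by linarith
  then have slot_I1: "slot j \<notin> I1" for j using B by blast
  have "finite ((\<lambda>(u, v). \<bar>v\<bar>) ` Q)" using finQ by simp
  then obtain V where V: "\<And>u v. (u, v) \<in> Q \<Longrightarrow> \<bar>v\<bar> \<le> V"
  proof -
    have "\<bar>v\<bar> \<le> Max ((\<lambda>(u, v). \<bar>v\<bar>) ` Q)" if "(u, v) \<in> Q" for u v
      using finQ that by (intro Max_ge) force+
    then show thesis using that by blast
  qed
  \<comment> \<open>Rows from \<open>-Z\<close> to \<open>Z\<close> contain all those named in
    \<open>A_eq\<close>, for every grid of \<open>Q\<close> and every slot; \<open>slot n\<close>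
    lies above all slots in use.\<close>
  define Z where "Z = V + M * (row (slot n) + 4)"
  define P where "P = (\<lambda>(\<alpha>, I). good Q s N \<alpha> I \<and> (\<forall>j<n. slot j \<notin> I))"
  define f where "f = (\<lambda>(\<alpha>, I :: nat set). card (rows \<alpha> (- Z) Z))"
  have "P (\<alpha>1, I1)" unfolding P_def using g1 slot_I1 by simp
  moreover have "\<forall>x. P x \<longrightarrow> f x < nat (6 * M) * nat (Z - - Z) + 1"
    using rows_bound(2)[of _ _ "- Z" Z] by (force simp: P_def f_def good_def)
  ultimately obtain x where x: "P x" "\<forall>y. P y \<longrightarrow> f y \<le> f x"
    using ex_has_greatest_nat[of P "(\<alpha>1, I1)" f] by blast
  obtain \<alpha>2 I2 where xe: "x = (\<alpha>2, I2)" by fastforce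
  have g2: "good Q s N \<alpha>2 I2" and slot2: "\<And>j. j < n \<Longrightarrow> slot j \<notin> I2" using x(1) by (auto simp: P_def xe)
  have mx: "card (rows \<beta> (- Z) Z) \<le> card (rows \<alpha>2 (- Z) Z)" if "good Q s N \<beta> J" "\<And>j. j < n \<Longrightarrow> slot j \<notin> J" for \<beta> J
    using x(2) that by (auto simp: P_def f_def xe)
  have "finite (I2 \<union> slot ` {..<n})" using g2 unfolding good_def by simp
  \<comment> \<open>A free hook that is not a slot: using it makes \<open>\<alpha>\<close> the
    result of a step while all slots stay free and maximality is kept.\<close>
  then obtain k0 where k0: "k0 \<notin> I2 \<union> slot ` {..<n}" using ex_new_if_finite[OF infinite_UNIV_nat] by blast
  have "k0 \<notin> I2" using k0 by simp
  then obtain \<beta> \<gamma>0 where \<beta>: "\<alpha>2 \<subseteq>\<^sub>m \<beta>" "attach \<beta> \<gamma>0" "good Q s N (\<beta> ++ \<gamma>0) (insert k0 I2)"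
    using good_model[OF g2 _ band] by blast
  define \<alpha> where "\<alpha> = \<beta> ++ \<gamma>0"
  define I where "I = insert k0 I2"
  have g: "good Q s N \<alpha> I" using \<beta>(3) by (simp add: \<alpha>_def I_def)
  have st: "stable \<tau>' \<alpha>" using \<beta>(2) by (simp add: attach_def \<alpha>_def)
  have slot_I: "slot j \<notin> I" if "j < n" for j using slot2[OF that] k0 that by (auto simp: I_def)
  have "\<alpha>2 \<subseteq>\<^sub>m \<alpha>" unfolding \<alpha>_def using \<beta>(1) attach_le[OF \<beta>(2)] map_le_trans by blast
  then have "card (rows \<alpha>2 (- Z) Z) \<le> card (rows \<alpha> (- Z) Z)"
    using g unfolding good_def by (intro card_mono[OF rows_bound(1)] rows_mono) auto
  then have mx': "card (rows \<beta>' (- Z) Z) \<le> card (rows \<alpha> (- Z) Z)" if "good Q s N \<beta>' I" for \<beta>'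
    using mx[OF that slot_I] by simp
  have "\<exists>A \<gamma>. \<forall>j<n. good Q s N (A j) I \<and> \<alpha> \<subseteq>\<^sub>m A j \<and> attach (A j) (\<gamma> j) \<and> plug_like (\<gamma> j) \<and>
     good Q s N (A j ++ \<gamma> j) (insert (slot j) I)"
    using good_model[OF g slot_I band] by metis
  then obtain A \<gamma> where A: "\<And>j. j < n \<Longrightarrow> good Q s N (A j) I \<and> \<alpha> \<subseteq>\<^sub>m A j \<and> attach (A j) (\<gamma> j) \<and> plug_like (\<gamma> j) \<and>
     good Q s N (A j ++ \<gamma> j) (insert (slot j) I)" by blast
  have A_eq: "A j (x, y) = \<alpha> (x, y)"
    if j: "j < n" and d: "(x, y) \<in> dom (A j)"
      and near: "\<And>u v. (u, v) \<in> Q \<Longrightarrow> v + M * (row (slot j) - 2) \<le> y \<and> y < v + M * (row (slot j) + 3)" for j x y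
  proof -
    obtain u v where q: "(u, v) \<in> Q" using cov by blast
    have "slot j \<le> slot n" using j by (simp add: slot_def)
    then have "M * (row (slot j) + 3) \<le> M * (row (slot n) + 4)" "M * (- 2) \<le> M * (row (slot j) - 2)"
      "M * 2 \<le> M * (row (slot n) + 4)"
      using row_mono[of "slot j" "slot n"] row_ge[of "slot j"] row_ge[of "slot n"] by (intro M_mono; linarith)+
    then have "- Z \<le> y" "y < Z" using near[OF q] V[OF q] unfolding Z_def by linarith+
    then have "(x, y) \<in> rows (A j) (- Z) Z" using d by (simp add: rows_def)
    moreover have "rows \<alpha> (- Z) Z = rows (A j) (- Z) Z"
      using A[OF j] mx'[of "A j"] by (intro card_seteq rows_mono rows_bound(1)) (auto simp: good_def)
    ultimately have "(x, y) \<in> rows \<alpha> (- Z) Z" by simp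
    then have "(x, y) \<in> dom \<alpha>" by (simp add: rows_def)
    then show ?thesis using A[OF j] unfolding map_le_def by force
  qed
  interpret pinched_simulation U SU \<tau>' m n R Q s N \<alpha> I slot A \<gamma>
    by unfold_locales (use m_ge_3 cov g band st slot_mod slot_I A A_eq in blast)+
  show False by (rule contradiction)
qed

theorem theorem3:
  shows "\<not> (\<exists>U :: tile set. finite U \<and>
            (\<forall>(T :: tile set) (S :: supertile set) (\<tau> :: nat).
               finite T \<and> \<tau> \<ge> 1 \<and> (\<forall>A\<in>S. supertile_over T A) \<longrightarrow>
               (\<exists>(SU :: supertile set) (\<tau>' :: nat) (m :: nat) R.
                  \<tau>' \<ge> 1 \<and> m \<ge> 1 \<and> (\<forall>A\<in>SU. supertile_over U A) \<and>
                  simulates SU \<tau>' T S \<tau> m R)))"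
proof
  assume "\<exists>U :: tile set. finite U \<and>
            (\<forall>(T :: tile set) (S :: supertile set) (\<tau> :: nat).
               finite T \<and> \<tau> \<ge> 1 \<and> (\<forall>A\<in>S. supertile_over T A) \<longrightarrow>
               (\<exists>(SU :: supertile set) (\<tau>' :: nat) (m :: nat) R.
                  \<tau>' \<ge> 1 \<and> m \<ge> 1 \<and> (\<forall>A\<in>SU. supertile_over U A) \<and>
                  simulates SU \<tau>' T S \<tau> m R))"
  then obtain U :: "tile set" where U: "finite U"
    "\<And>T S \<tau>. finite T \<and> \<tau> \<ge> 1 \<and> (\<forall>A\<in>S. supertile_over T A) \<Longrightarrow>
      \<exists>SU \<tau>' m R. \<tau>' \<ge> 1 \<and> m \<ge> 1 \<and> (\<forall>A\<in>SU. supertile_over U A) \<and> simulates SU \<tau>' T S \<tau> m R"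
    by blast
  define n where "n = (card U + 1) ^ 4 + 1"
  have "finite (target_tiles n) \<and> (1::nat) \<ge> 1 \<and> (\<forall>A\<in>target_init n. supertile_over (target_tiles n) A)"
    using target_init_over by (simp add: target_tiles_def n_def)
  from U(2)[OF this] obtain SU \<tau>' m R where "\<tau>' \<ge> 1" "m \<ge> 1" "\<forall>A\<in>SU. supertile_over U A"
    "simulates SU \<tau>' (target_tiles n) (target_init n) 1 m R" by blast
  then interpret simulation U SU \<tau>' m n R by unfold_locales (use U(1) n_def in auto)
  show False by (rule no_simulation)
qed

end
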